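(* The monads $\mathbb I=(I,\delta,\zeta)$ and $\mathbb J=(J,\delta,\xi)$ in the category $\mathrm{CUMET}$ of complete ultrametric spaces and nonexpanding maps are not isomorphic, i.e. no natural isomorphism $I\to J$ is a morphism of monads from $\mathbb I$ to $\mathbb J$.
   Context: $\mathrm{CUMET}$ is the category of complete ultrametric spaces and nonexpanding maps. On $\bar{\mathbb R}=\mathbb R\cup\{-\infty,\infty\}$, $\vee$ is maximum, $\wedge$ is minimum, and $\odot$ is addition, with $-\infty\odot x=-\infty$ for $x<\infty$. $C(X)$ is the set of continuous real-valued functions on $X$. $J_\omega(X)$ is the set of functionals $\vee_{i=1}^n\alpha_i\wedge\delta_{x_i}\colon C(X)\to\mathbb R$, $\varphi\mapsto\vee_{i}(\alpha_i\wedge\varphi(x_i))$, where $x_i\in X$, $\alpha_i\in\bar{\mathbb R}$, $\vee_i\alpha_i=\infty$. $I_\omega(X)$ is the set of functionals $\vee_{i=1}^n\alpha_i\odot\delta_{x_i}\colon C(X)\to\mathbb R$, $\varphi\mapsto\vee_i(\alpha_i\odot\varphi(x_i))$, where $x_i\in X$, $\alpha_i\in[-\infty,0]$, $\vee_i\alpha_i=0$. In both, $\delta_x$ is the functional $\varphi\mapsto\varphi(x)$. For an ultrametric space $(X,d)$ and $r>0$, $O_r(x)=\{y\mid d(x,y)<r\}$ and $\mathcal F_r(X)$ is the set of functions $X\to\mathbb R$ constant on each $O_r(x)$. Both $J_\omega(X)$ and $I_\omega(X)$ carry the ultrametric $\hat d(\mu,\nu)=\inf\{r>0\mid\mu(\varphi)=\nu(\varphi)\text{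 for all }\varphi\in\mathcal F_r(X)\}$. On nonexpanding maps: $J_\omega(f)(\vee_i\alpha_i\wedge\delta_{x_i})=\vee_i\alpha_i\wedge\delta_{f(x_i)}$, $I_\omega(f)(\vee_i\alpha_i\odot\delta_{x_i})=\vee_i\alpha_i\odot\delta_{f(x_i)}$; these are nonexpanding. Let $\xi_X\colon J_\omega^2(X)\to J_\omega(X)$ send $\vee_i\alpha_i\wedge\delta_{\mu_i}$ with $\mu_i=\vee_j\beta_{ij}\wedge\delta_{x_{ij}}$ to $\vee_i\vee_j(\alpha_i\wedge\beta_{ij})\wedge\delta_{x_{ij}}$, and $\zeta_X\colon I_\omega^2(X)\to I_\omega(X)$ send $\vee_i\alpha_i\odot\delta_{\mu_i}$ with $\mu_i=\vee_j\beta_{ij}\odot\delta_{x_{ij}}$ to $\vee_i\vee_j(\alpha_i\odot\beta_{ij})\odot\delta_{x_{ij}}$; these are nonexpanding. For complete $X$, $J(X)$ and $I(X)$ are the completions of $J_\omega(X)$ and $I_\omega(X)$; $J(f)$ and $I(f)$ are the unique nonexpanding extensions of $J_\omega(f)$, $I_\omega(f)$. Since $J_\omega^2(X)$ is dense in $J^2(X)$ (and likewise for $I$), $\xi_X$ and $\zeta_X$ extend uniquely to nonexpanding maps $\xi_X\colon J^2(X)\to J(X)$ and $\zeta_X\colon I^2(X)\to I(X)$. Both units are $x\mapsto\delta_x$. A morphism of monads $(T,\eta,\mu)\to(T',\eta',\mu')$ is a natural transformation $\alpha\colon T\to T'$ with $\alpha\circ\eta=\eta'$ and $\mu'\circ T'(\alpha)\circ\alpha_T=\alpha\circ\mu$.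 *)

theory Defs
  imports "HOL-Analysis.Analysis"
begin

section \<open>Ultrametric spaces and nonexpanding maps\<close>

definition ultrametric :: "'a metric \<Rightarrow> bool" where
  "ultrametric X \<longleftrightarrow>
     (\<forall>x\<in>mspace X. \<forall>y\<in>mspace X. \<forall>z\<in>mspace X. mdist X x z \<le> max (mdist X x y) (mdist X y z))"

text \<open>Maps are extensional, so that two morphisms are equal iff they agree on the carrier.\<close>

definition nonexpanding :: "'a metric \<Rightarrow> 'b metric \<Rightarrow> ('a \<Rightarrow> 'b) set" where
  "nonexpanding X Y =
     {f \<in> mspace X \<rightarrow>\<^sub>E mspace Y. \<forall>x\<in>mspace X. \<forall>y\<in>mspace X. mdist Y (f x) (f y) \<le> mdist X x y}"

definition cumet :: "'a metric set" where
  "cumet = {X. mcomplete_of X \<and> ultrametric X}"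

section \<open>Functionals\<close>

definition cont_funs :: "'a metric \<Rightarrow> ('a \<Rightarrow> real) set" where
  "cont_funs X = {\<phi> \<in> extensional (mspace X). continuous_map (mtopology_of X) euclideanreal \<phi>}"

definition ball_const_funs :: "real \<Rightarrow> 'a metric \<Rightarrow> ('a \<Rightarrow> real) set" where
  "ball_const_funs r X = {\<phi> \<in> extensional (mspace X). \<forall>x\<in>mspace X. \<phi> constant_on mball_of X x r}"

definition dirac :: "'a metric \<Rightarrow> 'a \<Rightarrow> ('a \<Rightarrow> real) \<Rightarrow> real" where
  "dirac X x = (\<lambda>\<phi>\<in>cont_funs X. \<phi> x)"

text \<open>
  The two constructions are treated uniformly: \<open>oper\<close> is an operation on the extended reals with
  neutral element \<open>e\<close>.  For \<open>J\<close> these are minimum and \<open>\<infinity>\<close>; for \<open>I\<close> they are addition and \<open>0\<close>.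
  A formal combination of Dirac functionals is a list of pairs \<open>(\<alpha>\<^sub>i, x\<^sub>i)\<close>.
  The maximum of the coefficients has to be \<open>e\<close>; in particular all coefficients are at most \<open>e\<close>,
  so for \<open>I\<close> they lie in \<open>[-\<infinity>, 0]\<close>, where addition of extended reals is associative and
  \<open>-\<infinity>\<close> is absorbing.
\<close>

definition combos :: "ereal \<Rightarrow> 'a metric \<Rightarrow> (ereal \<times> 'a) list set" where
  "combos e X = {xs. xs \<noteq> [] \<and> snd ` set xs \<subseteq> mspace X \<and> Max (fst ` set xs) = e}"

definition functional ::
    "(ereal \<Rightarrow> ereal \<Rightarrow> ereal) \<Rightarrow> 'a metric \<Rightarrow> (ereal \<times> 'a) list \<Rightarrow> ('a \<Rightarrow> real) \<Rightarrow> real" where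
  "functional oper X xs =
     (\<lambda>\<phi>\<in>cont_funs X. real_of_ereal (MAX (\<alpha>, x)\<in>set xs. oper \<alpha> (ereal (\<phi> x))))"

definition dhat :: "'a metric \<Rightarrow> (('a \<Rightarrow> real) \<Rightarrow> real) \<Rightarrow> (('a \<Rightarrow> real) \<Rightarrow> real) \<Rightarrow> real" where
  "dhat X \<mu> \<nu> = Inf {r. 0 < r \<and> (\<forall>\<phi>\<in>ball_const_funs r X. \<mu> \<phi> = \<nu> \<phi>)}"

definition omega_set ::
    "(ereal \<Rightarrow> ereal \<Rightarrow> ereal) \<Rightarrow> ereal \<Rightarrow> 'a metric \<Rightarrow> (('a \<Rightarrow> real) \<Rightarrow> real) set" where
  "omega_set oper e X = functional oper X ` combos e X"

text \<open>
  The distance is set to \<open>0\<close> off the carrier only because the type of metric spaces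
  requires it to be symmetric and nonnegative everywhere.
\<close>

definition omega ::
    "(ereal \<Rightarrow> ereal \<Rightarrow> ereal) \<Rightarrow> ereal \<Rightarrow> 'a metric \<Rightarrow> (('a \<Rightarrow> real) \<Rightarrow> real) metric" where
  "omega oper e X = metric (omega_set oper e X,
     \<lambda>\<mu> \<nu>. if \<mu> \<in> omega_set oper e X \<and> \<nu> \<in> omega_set oper e X then dhat X \<mu> \<nu> else 0)"

definition omega_map ::
    "(ereal \<Rightarrow> ereal \<Rightarrow> ereal) \<Rightarrow> ereal \<Rightarrow> 'a metric \<Rightarrow> 'b metric \<Rightarrow> ('a \<Rightarrow> 'b)
      \<Rightarrow> (('a \<Rightarrow> real) \<Rightarrow> real) \<Rightarrow> (('b \<Rightarrow> real) \<Rightarrow> real)" where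
  "omega_map oper e X Y f = (\<lambda>\<mu>\<in>mspace (omega oper e X). THE \<nu>. \<exists>xs\<in>combos e X.
     \<mu> = functional oper X xs \<and> \<nu> = functional oper Y [(\<alpha>, f x). (\<alpha>, x) \<leftarrow> xs])"

text \<open>An element of the doubly iterated space is represented by a list of pairs \<open>(\<alpha>\<^sub>i, xs\<^sub>i)\<close>,
  where the list \<open>xs\<^sub>i\<close> represents the functional \<open>\<mu>\<^sub>i\<close>.\<close>

definition omega_mult ::
    "(ereal \<Rightarrow> ereal \<Rightarrow> ereal) \<Rightarrow> ereal \<Rightarrow> 'a metric
      \<Rightarrow> (((('a \<Rightarrow> real) \<Rightarrow> real) \<Rightarrow> real) \<Rightarrow> real) \<Rightarrow> (('a \<Rightarrow> real) \<Rightarrow> real)" where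
  "omega_mult oper e X = (\<lambda>M\<in>mspace (omega oper e (omega oper e X)). THE \<nu>. \<exists>xss.
     (\<forall>(\<alpha>, xs)\<in>set xss. xs \<in> combos e X) \<and>
     [(\<alpha>, functional oper X xs). (\<alpha>, xs) \<leftarrow> xss] \<in> combos e (omega oper e X) \<and>
     M = functional oper (omega oper e X) [(\<alpha>, functional oper X xs). (\<alpha>, xs) \<leftarrow> xss] \<and>
     \<nu> = functional oper X [(oper \<alpha> \<beta>, x). (\<alpha>, xs) \<leftarrow> xss, (\<beta>, x) \<leftarrow> xs])"

section \<open>Completion\<close>

text \<open>
  The category needs a fixed type of points that is closed under the constructions.  The following
  type contains a copy of an arbitrary type \<open>'a\<close> and is closed under countable sequences, so it
  has room for a completion of every space of functionals considered here
  (lemma \<open>completion_omega\<close> below).  Since \<open>'a\<close> is arbitrary, so is the size of the spaces.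
\<close>

datatype 'a universe = Point 'a | Seq "nat \<Rightarrow> 'a universe"

definition is_completion :: "'b metric \<Rightarrow> 'c metric \<Rightarrow> ('b \<Rightarrow> 'c) \<Rightarrow> bool" where
  "is_completion M K i \<longleftrightarrow> mcomplete_of K \<and> i \<in> mspace M \<rightarrow>\<^sub>E mspace K \<and>
     (\<forall>x\<in>mspace M. \<forall>y\<in>mspace M. mdist K (i x) (i y) = mdist M x y) \<and>
     mtopology_of K closure_of (i ` mspace M) = mspace K"

definition metric_completion :: "'b metric \<Rightarrow> 'a universe metric \<times> ('b \<Rightarrow> 'a universe)" where
  "metric_completion M = (SOME (K, i). is_completion M K i)"

section \<open>Monads\<close>

text \<open>The functor part, the unit and the multiplication of a monad on \<open>cumet\<close>; the action on
  morphisms takes the domain and the codomain as arguments.\<close>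

record 'u monad_data =
  Ob :: "'u metric \<Rightarrow> 'u metric"
  Map :: "'u metric \<Rightarrow> 'u metric \<Rightarrow> ('u \<Rightarrow> 'u) \<Rightarrow> ('u \<Rightarrow> 'u)"
  Unit :: "'u metric \<Rightarrow> 'u \<Rightarrow> 'u"
  Mult :: "'u metric \<Rightarrow> 'u \<Rightarrow> 'u"

definition natural_transformation ::
    "'u monad_data \<Rightarrow> 'u monad_data \<Rightarrow> ('u metric \<Rightarrow> 'u \<Rightarrow> 'u) \<Rightarrow> bool" where
  "natural_transformation T T' a \<longleftrightarrow>
     (\<forall>X\<in>cumet. a X \<in> nonexpanding (Ob T X) (Ob T' X)) \<and>
     (\<forall>X\<in>cumet. \<forall>Y\<in>cumet. \<forall>f\<in>nonexpanding X Y.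
        compose (mspace (Ob T X)) (Map T' X Y f) (a X) =
        compose (mspace (Ob T X)) (a Y) (Map T X Y f))"

definition natural_isomorphism ::
    "'u monad_data \<Rightarrow> 'u monad_data \<Rightarrow> ('u metric \<Rightarrow> 'u \<Rightarrow> 'u) \<Rightarrow> bool" where
  "natural_isomorphism T T' a \<longleftrightarrow> natural_transformation T T' a \<and>
     (\<forall>X\<in>cumet. \<exists>b\<in>nonexpanding (Ob T' X) (Ob T X).
        compose (mspace (Ob T X)) b (a X) = (\<lambda>x\<in>mspace (Ob T X). x) \<and>
        compose (mspace (Ob T' X)) (a X) b = (\<lambda>x\<in>mspace (Ob T' X). x))"

definition monad_morphism ::
    "'u monad_data \<Rightarrow> 'u monad_data \<Rightarrow> ('u metric \<Rightarrow> 'u \<Rightarrow> 'u) \<Rightarrow> bool" where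
  "monad_morphism T T' a \<longleftrightarrow> natural_transformation T T' a \<and>
     (\<forall>X\<in>cumet. compose (mspace X) (a X) (Unit T X) = Unit T' X) \<and>
     (\<forall>X\<in>cumet. compose (mspace (Ob T (Ob T X))) (Mult T' X)
          (compose (mspace (Ob T (Ob T X))) (Map T' (Ob T X) (Ob T' X) (a X)) (a (Ob T X))) =
        compose (mspace (Ob T (Ob T X))) (a X) (Mult T X))"

context
  fixes oper :: "ereal \<Rightarrow> ereal \<Rightarrow> ereal" and e :: ereal
begin

definition compl_ob :: "'a universe metric \<Rightarrow> 'a universe metric" where
  "compl_ob X = fst (metric_completion (omega oper e X))"

definition compl_emb ::
    "'a universe metric \<Rightarrow> (('a universe \<Rightarrow> real) \<Rightarrow> real) \<Rightarrow> 'a universe" where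
  "compl_emb X = snd (metric_completion (omega oper e X))"

definition compl_map :: "'a universe metric \<Rightarrow> 'a universe metric
    \<Rightarrow> ('a universe \<Rightarrow> 'a universe) \<Rightarrow> ('a universe \<Rightarrow> 'a universe)" where
  "compl_map X Y f = (THE g. g \<in> nonexpanding (compl_ob X) (compl_ob Y) \<and>
     (\<forall>\<mu>\<in>mspace (omega oper e X). g (compl_emb X \<mu>) = compl_emb Y (omega_map oper e X Y f \<mu>)))"

definition compl_unit :: "'a universe metric \<Rightarrow> 'a universe \<Rightarrow> 'a universe" where
  "compl_unit X = (\<lambda>x\<in>mspace X. compl_emb X (dirac X x))"

text \<open>The dense embedding of the doubly iterated space of functionals into the doubly iterated
  completion applies the functor to the inner embedding and then the outer embedding.\<close>

definition compl_mult :: "'a universe metric \<Rightarrow> 'a universe \<Rightarrow> 'a universe" where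
  "compl_mult X = (THE g. g \<in> nonexpanding (compl_ob (compl_ob X)) (compl_ob X) \<and>
     (\<forall>M\<in>mspace (omega oper e (omega oper e X)).
        g (compl_emb (compl_ob X) (omega_map oper e (omega oper e X) (compl_ob X) (compl_emb X) M)) =
        compl_emb X (omega_mult oper e X M)))"

definition compl_monad :: "'a universe monad_data" where
  "compl_monad = \<lparr>Ob = compl_ob, Map = compl_map, Unit = compl_unit, Mult = compl_mult\<rparr>"

end

definition I_monad :: "'a universe monad_data" where
  "I_monad = compl_monad (+) 0"

definition J_monad :: "'a universe monad_data" where
  "J_monad = compl_monad min \<infinity>"


section \<open>The functionals form a metric space, and its completion exists\<close>

lemma ball_const_funs_subset:
  assumes "0 < r"
  shows "ball_const_funs r X \<subseteq> cont_funs X"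
proof
  fix \<phi> assume \<phi>: "\<phi> \<in> ball_const_funs r X"
  interpret Metric_space "mspace X" "mdist X" by simp
  have const: "\<phi> y = \<phi> x" if "x \<in> mspace X" "y \<in> mball x r" for x y
  proof -
    have "\<phi> constant_on mball_of X x r" using \<phi> that by (auto simp: ball_const_funs_def)
    moreover have "x \<in> mball_of X x r" "y \<in> mball_of X x r" using that assms by auto
    ultimately show ?thesis unfolding constant_on_def by metis
  qed
  have "continuous_map mtopology euclideanreal \<phi>"
    unfolding continuous_map_def
  proof (intro conjI allI impI)
    fix U :: "real set" assume "openin euclideanreal U"
    have "\<exists>s>0. mball x s \<subseteq> {x \<in> mspace X. \<phi> x \<in> U}" if "x \<in> mspace X" "\<phi> x \<in> U" for x
    proof (intro exI conjI subsetI)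
      fix y assume y: "y \<in> mball x r"
      then show "y \<in> {x \<in> mspace X. \<phi> x \<in> U}" using const[OF that(1) y] that by simp
    qed (rule assms)
    then show "openin mtopology {x \<in> topspace mtopology. \<phi> x \<in> U}"
      by (auto simp: openin_mtopology)
  qed auto
  then show "\<phi> \<in> cont_funs X"
    using \<phi> by (simp add: cont_funs_def ball_const_funs_def mtopology_of_def)
qed

lemma ball_const_funs_antimono: "r \<le> s \<Longrightarrow> ball_const_funs s X \<subseteq> ball_const_funs r X"
  unfolding ball_const_funs_def constant_on_def by fastforce

lemma functional_cong:
  assumes "\<phi> \<in> cont_funs X" "\<psi> \<in> cont_funs X" "\<And>x. x \<in> snd ` set xs \<Longrightarrow> \<phi> x = \<psi> x"
  shows "functional oper X xs \<phi> = functional oper X xs \<psi>"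
proof -
  have "(\<lambda>(\<alpha>, x). oper \<alpha> (ereal (\<phi> x))) ` set xs = (\<lambda>(\<alpha>, x). oper \<alpha> (ereal (\<psi> x))) ` set xs"
    using assms(3) by (intro image_cong) force+
  then show ?thesis using assms(1,2) by (simp add: functional_def)
qed

text \<open>Both instances of \<open>oper\<close> and \<open>e\<close> satisfy the following.\<close>

locale coefficients =
  fixes oper :: "ereal \<Rightarrow> ereal \<Rightarrow> ereal" and e :: ereal
  assumes oper_mono: "\<alpha> \<le> \<beta> \<Longrightarrow> oper \<alpha> c \<le> oper \<beta> c"
    and oper_neutral: "oper e c = c"
begin

lemma functional_const:
  assumes xs: "xs \<in> combos e X" and "\<phi> \<in> cont_funs X" and c: "\<And>x. x \<in> snd ` set xs \<Longrightarrow> \<phi> x = c"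
  shows "functional oper X xs \<phi> = c"
proof -
  have "(\<lambda>(\<alpha>, x). oper \<alpha> (ereal (\<phi> x))) ` set xs = (\<lambda>\<alpha>. oper \<alpha> (ereal c)) ` (fst ` set xs)"
    unfolding image_image using c by (intro image_cong) force+
  moreover have "Max ((\<lambda>\<alpha>. oper \<alpha> (ereal c)) ` (fst ` set xs)) = oper (Max (fst ` set xs)) (ereal c)"
    using xs by (intro mono_Max_commute[symmetric]) (auto simp: combos_def oper_mono intro: monoI)
  ultimately show ?thesis
    using assms by (simp add: functional_def combos_def oper_neutral)
qed

lemma agree_exists:
  assumes "xs \<in> combos e X" "ys \<in> combos e X"
  shows "\<exists>r>0. \<forall>\<phi>\<in>ball_const_funs r X. functional oper X xs \<phi> = functional oper X ys \<phi>"
proof -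
  define P where "P = snd ` set xs \<union> snd ` set ys"
  have P: "finite P" "P \<subseteq> mspace X" using assms by (auto simp: P_def combos_def)
  obtain p where p: "p \<in> snd ` set xs"
    using assms(1) by (metis (mono_tags, lifting) combos_def ex_in_conv image_is_empty mem_Collect_eq set_empty)
  define r where "r = Max (mdist X p ` P) + 1"
  have less: "mdist X p q < r" if "q \<in> P" for q
    using that P unfolding r_def by (smt (verit) Max_ge finite_imageI imageI)
  have p': "p \<in> P" "p \<in> mspace X" using p P by (auto simp: P_def)
  have r: "0 < r" using less[OF p'(1)] by (smt (verit) mdist_nonneg)
  have "functional oper X xs \<phi> = functional oper X ys \<phi>" if \<phi>: "\<phi> \<in> ball_const_funs r X" for \<phi>
  proof -
    have "\<phi> constant_on mball_of X p r" using \<phi> p' by (auto simp: ball_const_funs_def)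
    moreover have "P \<subseteq> mball_of X p r" using less P p' by auto
    ultimately obtain c where "\<And>q. q \<in> P \<Longrightarrow> \<phi> q = c" by (auto simp: constant_on_def)
    moreover have "\<phi> \<in> cont_funs X" using ball_const_funs_subset[OF r] \<phi> by blast
    ultimately show ?thesis
      using functional_const[OF assms(1), of \<phi> c] functional_const[OF assms(2), of \<phi> c]
      by (simp add: P_def)
  qed
  then show ?thesis using r by blast
qed

lemma agree_imp_eq:
  assumes X: "ultrametric X" and xs: "xs \<in> combos e X" and ys: "ys \<in> combos e X"
    and agree: "\<And>r \<phi>. 0 < r \<Longrightarrow> \<phi> \<in> ball_const_funs r X \<Longrightarrow>
      functional oper X xs \<phi> = functional oper X ys \<phi>"
  shows "functional oper X xs = functional oper X ys"
proof
  fix \<phi>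
  show "functional oper X xs \<phi> = functional oper X ys \<phi>"
  proof (cases "\<phi> \<in> cont_funs X")
    case False
    then show ?thesis by (simp add: functional_def)
  next
    case True
    define P where "P = snd ` set xs \<union> snd ` set ys"
    have P: "finite P" "P \<subseteq> mspace X" using xs ys by (auto simp: P_def combos_def)
    define D where "D = insert 1 ((\<lambda>(p, q). mdist X p q) ` {(p, q) \<in> P \<times> P. p \<noteq> q})"
    have "finite {(p, q) \<in> P \<times> P. p \<noteq> q}"
      by (rule finite_subset[of _ "P \<times> P"]) (use P in auto)
    then have finD: "finite D" by (simp add: D_def)
    define r where "r = Min D"
    have pos: "0 < d" if d: "d \<in> D" for d
    proof -
      consider "d = 1" | p q where "p \<in> P" "q \<in> P" "p \<noteq> q" "d = mdist X p q"
        using d by (auto simp: D_def)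
      then show ?thesis
      proof cases
        case 2
        then have "mdist X p q \<noteq> 0" using P(2) by (simp add: subset_iff)
        then show ?thesis using 2 mdist_nonneg[of X p q] by linarith
      qed simp
    qed
    have r: "0 < r" unfolding r_def using finD pos by (subst Min_gr_iff) (auto simp: D_def)
    have sep: "p = q" if "p \<in> P" "q \<in> P" "mdist X p q < r" for p q
    proof (rule ccontr)
      assume "p \<noteq> q"
      then have "mdist X p q \<in> D" using that by (auto simp: D_def)
      then have "r \<le> mdist X p q" unfolding r_def using finD by simp
      then show False using that by simp
    qed
    have um: "mdist X x z < r"
      if "x \<in> mspace X" "y \<in> mspace X" "z \<in> mspace X" "mdist X x y < r" "mdist X y z < r" for x y z
      using X that unfolding ultrametric_def by (smt (verit) max_def)
    define near where "near y p \<longleftrightarrow> p \<in> P \<and> mdist X p y < r" for y p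
    define \<psi> where "\<psi> = (\<lambda>y\<in>mspace X. if \<exists>p. near y p then \<phi> (SOME p. near y p) else 0)"
    have near_cong: "near y p \<longleftrightarrow> near x p"
      if "x \<in> mspace X" "y \<in> mspace X" "mdist X x y < r" for x y p
      using that P(2) um[of p x y] um[of p y x] mdist_commute[of X x y] unfolding near_def by auto
    have \<psi>F: "\<psi> \<in> ball_const_funs r X"
      unfolding ball_const_funs_def
    proof (intro CollectI conjI ballI)
      fix x assume x: "x \<in> mspace X"
      have "\<psi> y = \<psi> x" if "y \<in> mball_of X x r" for y
      proof -
        have y: "y \<in> mspace X" using that by simp
        have "near y = near x" using near_cong[OF x y] that by (intro ext) simp
        moreover have "\<psi> z = (if \<exists>p. near z p then \<phi> (SOME p. near z p) else 0)"
          if "z \<in> mspace X" for z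
          using that unfolding \<psi>_def by (rule restrict_apply')
        ultimately show ?thesis using x y by metis
      qed
      then show "\<psi> constant_on mball_of X x r" by (auto simp: constant_on_def)
    qed (simp add: \<psi>_def)
    then have \<psi>C: "\<psi> \<in> cont_funs X" using ball_const_funs_subset[OF r] by blast
    have eq: "\<phi> p = \<psi> p" if "p \<in> P" for p
    proof -
      have "mdist X p p = 0" using that P(2) by (simp add: subset_iff)
      then have p: "near p p" using that r by (simp add: near_def)
      then have "near p (SOME q. near p q)" by (rule someI)
      then have "p = (SOME q. near p q)"
        using that sep[of "SOME q. near p q" p] by (simp add: near_def)
      moreover have "\<psi> p = \<phi> (SOME q. near p q)"
      proof -
        have "p \<in> mspace X" "\<exists>q. near p q" using that P(2) p by blast+
        then show ?thesis unfolding \<psi>_def by (simp only: restrict_apply' if_True)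
      qed
      ultimately show ?thesis by simp
    qed
    have "functional oper X xs \<phi> = functional oper X xs \<psi>"
      by (rule functional_cong[OF True \<psi>C]) (simp add: eq P_def)
    also have "\<dots> = functional oper X ys \<psi>" by (rule agree[OF r \<psi>F])
    also have "\<dots> = functional oper X ys \<phi>"
      by (rule functional_cong[OF \<psi>C True]) (simp add: eq P_def)
    finally show ?thesis .
  qed
qed

lemma Metric_space_omega:
  assumes X: "ultrametric X"
  defines "A \<equiv> omega_set oper e X"
  shows "Metric_space A (\<lambda>\<mu> \<nu>. if \<mu> \<in> A \<and> \<nu> \<in> A then dhat X \<mu> \<nu> else 0)"
proof -
  define R where "R \<mu> \<nu> = {r. 0 < r \<and> (\<forall>\<phi>\<in>ball_const_funs r X. \<mu> \<phi> = \<nu> \<phi>)}" for \<mu> \<nu> :: "('a \<Rightarrow> real) \<Rightarrow> real"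
  have d: "dhat X \<mu> \<nu> = Inf (R \<mu> \<nu>)" for \<mu> \<nu> by (simp add: dhat_def R_def)
  have ne: "R \<mu> \<nu> \<noteq> {}" if "\<mu> \<in> A" "\<nu> \<in> A" for \<mu> \<nu>
    using that agree_exists unfolding R_def A_def omega_set_def by blast
  have bdd: "bdd_below (R \<mu> \<nu>)" for \<mu> \<nu>
    by (rule bdd_belowI[of _ 0]) (auto simp: R_def)
  have up: "s \<in> R \<mu> \<nu>" if "r \<in> R \<mu> \<nu>" "r \<le> s" for r s \<mu> \<nu>
    using that ball_const_funs_antimono[OF that(2), of X] unfolding R_def by auto
  have nonneg: "0 \<le> dhat X \<mu> \<nu>" if "\<mu> \<in> A" "\<nu> \<in> A" for \<mu> \<nu>
    unfolding d using ne[OF that] by (rule cInf_greatest) (auto simp: R_def)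
  have mem: "r \<in> R \<mu> \<nu>" if "\<mu> \<in> A" "\<nu> \<in> A" "dhat X \<mu> \<nu> < r" for \<mu> \<nu> r
  proof -
    have "\<exists>s\<in>R \<mu> \<nu>. s < r" using that ne cInf_lessD unfolding d by blast
    then show ?thesis using up by (meson less_imp_le)
  qed
  have refl: "dhat X \<mu> \<mu> = 0" if "\<mu> \<in> A" for \<mu>
  proof -
    have "R \<mu> \<mu> = {0<..}" by (auto simp: R_def)
    then show ?thesis unfolding d by simp
  qed
  have eqI: "\<mu> = \<nu>" if A: "\<mu> \<in> A" "\<nu> \<in> A" and 0: "dhat X \<mu> \<nu> = 0" for \<mu> \<nu>
  proof -
    obtain xs ys where *: "xs \<in> combos e X" "ys \<in> combos e X"
      "\<mu> = functional oper X xs" "\<nu> = functional oper X ys"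
      using A by (auto simp: A_def omega_set_def)
    show ?thesis unfolding *(3,4)
    proof (rule agree_imp_eq[OF X *(1,2)])
      fix r :: real and \<phi> assume "0 < r" "\<phi> \<in> ball_const_funs r X"
      then show "functional oper X xs \<phi> = functional oper X ys \<phi>"
        using mem[OF A, of r] 0 * by (auto simp: R_def)
    qed
  qed
  have tri: "dhat X \<mu> \<rho> \<le> dhat X \<mu> \<nu> + dhat X \<nu> \<rho>" if "\<mu> \<in> A" "\<nu> \<in> A" "\<rho> \<in> A" for \<mu> \<nu> \<rho>
  proof (rule field_le_epsilon)
    fix t :: real assume t: "0 < t"
    let ?r = "dhat X \<mu> \<nu> + dhat X \<nu> \<rho> + t"
    have "?r \<in> R \<mu> \<nu>" "?r \<in> R \<nu> \<rho>"
      using nonneg[OF that(1,2)] nonneg[OF that(2,3)] that t by (auto intro!: mem)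
    then have "?r \<in> R \<mu> \<rho>" by (auto simp: R_def)
    then show "dhat X \<mu> \<rho> \<le> ?r" unfolding d[of \<mu> \<rho>] using bdd by (rule cInf_lower)
  qed
  have sym: "dhat X \<mu> \<nu> = dhat X \<nu> \<mu>" for \<mu> \<nu>
    unfolding d R_def by (rule arg_cong[of _ _ Inf]) auto
  show ?thesis
    by unfold_locales (use nonneg sym refl eqI tri in auto)
qed

lemma mspace_omega: "ultrametric X \<Longrightarrow> mspace (omega oper e X) = omega_set oper e X"
  unfolding omega_def by (rule Metric_space.mspace_metric[OF Metric_space_omega])

end

interpretation max_plus: coefficients "(+)" 0
  by unfold_locales (auto intro: add_right_mono)

interpretation max_min: coefficients min \<infinity>
  by unfold_locales (auto simp: min_def)

lemma completion_exists:
  fixes M :: "'b metric" and h :: "'b \<Rightarrow> 'a universe"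
  assumes h: "inj_on h (mspace M)"
  shows "\<exists>(K :: 'a universe metric) i. is_completion M K i"
proof -
  interpret M: Metric_space "mspace M" "mdist M" by simp
  obtain f :: "['b, 'b] \<Rightarrow> real" and m' where m': "mcomplete_of m'" "f \<in> mspace M \<rightarrow> mspace m'"
      "mtopology_of m' closure_of f ` mspace M = mspace m'"
      "\<And>x y. \<lbrakk>x \<in> mspace M; y \<in> mspace M\<rbrakk> \<Longrightarrow> mdist m' (f x) (f y) = mdist M x y"
    using M.metric_completion by metis
  interpret N: Metric_space "mspace m'" "mdist m'" by simp
  have "\<exists>\<sigma>. (\<forall>n. \<sigma> n \<in> mspace M) \<and> limitin N.mtopology (\<lambda>n. f (\<sigma> n)) y sequentially"
    if "y \<in> mspace m'" for y
  proof -
    have "y \<in> N.mtopology closure_of f ` mspace M" using that m'(3) by (simp add: mtopology_of_def)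
    then obtain \<tau> where "range \<tau> \<subseteq> f ` mspace M \<inter> mspace m'" "limitin N.mtopology \<tau> y sequentially"
      by (auto simp: N.closure_of_sequentially)
    then have \<tau>: "range \<tau> \<subseteq> f ` mspace M" "limitin N.mtopology \<tau> y sequentially" by auto
    then have "\<forall>n. \<exists>x\<in>mspace M. \<tau> n = f x" by blast
    then obtain \<sigma> where "\<And>n. \<sigma> n \<in> mspace M \<and> \<tau> n = f (\<sigma> n)" by metis
    then show ?thesis using \<tau>(2) by (metis (no_types, lifting) ext)
  qed
  then obtain \<sigma> where \<sigma>: "\<And>y n. y \<in> mspace m' \<Longrightarrow> \<sigma> y n \<in> mspace M"
      "\<And>y. y \<in> mspace m' \<Longrightarrow> limitin N.mtopology (\<lambda>n. f (\<sigma> y n)) y sequentially"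
    by metis
  define k where "k y = Seq (\<lambda>n. h (\<sigma> y n))" for y
  have k: "inj_on k (mspace m')"
  proof (rule inj_onI)
    fix y z assume yz: "y \<in> mspace m'" "z \<in> mspace m'" "k y = k z"
    then have "h (\<sigma> y n) = h (\<sigma> z n)" for n by (simp add: k_def fun_eq_iff)
    then have "\<sigma> y = \<sigma> z" using \<sigma>(1) yz h by (auto simp: inj_on_def fun_eq_iff)
    then show "y = z" using \<sigma>(2) yz N.limitin_metric_unique by (metis trivial_limit_sequentially)
  qed
  define g where "g = the_inv_into (mspace m') k"
  have gk: "g (k y) = y" if "y \<in> mspace m'" for y
    unfolding g_def using k that by (rule the_inv_into_f_f)
  define d where "d u v = mdist m' (g u) (g v)" for u v
  interpret K: Metric_space "k ` mspace m'" d
    by unfold_locales (auto simp: d_def gk mdist_commute mdist_triangle)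
  have lim: "limitin K.mtopology (\<lambda>n. k (s n)) (k y) sequentially"
    if "limitin N.mtopology s y sequentially" "range s \<subseteq> mspace m'" for s y
    using that by (auto simp: K.limit_metric_sequentially N.limit_metric_sequentially d_def gk subset_iff)
  have "K.mcomplete"
    unfolding K.mcomplete_def
  proof (intro allI impI)
    fix s assume s: "K.MCauchy s"
    then have "\<forall>n. \<exists>y\<in>mspace m'. s n = k y" by (auto simp: K.MCauchy_def image_iff subset_iff)
    then obtain t where t: "\<And>n. t n \<in> mspace m' \<and> s n = k (t n)" by metis
    then have "N.MCauchy t"
      using s by (auto simp: K.MCauchy_def N.MCauchy_def d_def gk)
    then obtain y where "limitin N.mtopology t y sequentially"
      using m'(1) unfolding mcomplete_of_def N.mcomplete_def by blast
    then have "limitin K.mtopology (\<lambda>n. k (t n)) (k y) sequentially" by (rule lim) (use t in auto)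
    moreover have "s = (\<lambda>n. k (t n))" using t by auto
    ultimately show "\<exists>x. limitin K.mtopology s x sequentially" by blast
  qed
  moreover have "K.mtopology closure_of ((\<lambda>x\<in>mspace M. k (f x)) ` mspace M) = k ` mspace m'"
  proof
    show "k ` mspace m' \<subseteq> K.mtopology closure_of ((\<lambda>x\<in>mspace M. k (f x)) ` mspace M)"
    proof
      fix u assume "u \<in> k ` mspace m'"
      then obtain y where y: "y \<in> mspace m'" "u = k y" by blast
      have "limitin K.mtopology (\<lambda>n. k (f (\<sigma> y n))) u sequentially"
        unfolding y(2) by (rule lim) (use \<sigma> y m'(2) in auto)
      then show "u \<in> K.mtopology closure_of ((\<lambda>x\<in>mspace M. k (f x)) ` mspace M)"
        unfolding K.closure_of_sequentially using \<sigma>(1)[OF y(1)] y(1) m'(2)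
        by (intro CollectI conjI exI[of _ "\<lambda>n. k (f (\<sigma> y n))"]) (auto simp: y(2) Pi_iff)
    qed
  qed (use closure_of_subset_topspace[of K.mtopology] in simp)
  ultimately have "is_completion M (metric (k ` mspace m', d)) (\<lambda>x\<in>mspace M. k (f x))"
    using m'(2,4) by (auto simp: is_completion_def d_def gk Pi_iff)
  then show ?thesis by blast
qed

lemma inj_ereal_universe: "\<exists>c :: ereal \<Rightarrow> 'a universe. inj c"
proof -
  define b :: "bool \<Rightarrow> 'a universe" where
    "b t = (if t then Point undefined else Seq (\<lambda>_. Point undefined))" for t
  define c :: "ereal \<Rightarrow> 'a universe" where
    "c x = Seq (\<lambda>n. b (ereal (of_rat (from_nat n)) < x))" for x
  have b: "b s = b t \<longleftrightarrow> s = t" for s t by (simp add: b_def)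
  have "x = y" if "c x = c y" for x y
  proof -
    have iff: "ereal (of_rat q) < x \<longleftrightarrow> ereal (of_rat q) < y" for q
    proof -
      have "ereal (of_rat (from_nat (to_nat q))) < x \<longleftrightarrow> ereal (of_rat (from_nat (to_nat q))) < y"
        using that unfolding c_def universe.inject fun_eq_iff b by blast
      then show ?thesis by simp
    qed
    have "\<not> u < v" if "\<And>q. ereal (of_rat q) < v \<longleftrightarrow> ereal (of_rat q) < u" for u v :: ereal
      using that ereal_dense3[of u v] by (auto dest: less_asym)
    then show ?thesis using iff by (meson linorder_cases)
  qed
  then show ?thesis by (intro exI[of _ c] injI)
qed

lemma completion_omega:
  fixes X :: "'a universe metric"
  assumes "coefficients oper e" "ultrametric X"
  shows "is_completion (omega oper e X)
    (fst (metric_completion (omega oper e X)) :: 'a universe metric) (snd (metric_completion (omega oper e X)))"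
proof -
  obtain c :: "ereal \<Rightarrow> 'a universe" where c: "inj c" using inj_ereal_universe by blast
  define pair where "pair = (\<lambda>(\<alpha>, x). Seq (\<lambda>n::nat. if n = 0 then x else c \<alpha>))"
  have pair: "inj pair"
    by (rule injI) (use c in \<open>auto simp: pair_def fun_eq_iff inj_def split: if_splits; metis zero_neq_one\<close>)
  define code where
    "code xs = Seq (\<lambda>n. if n < length xs then pair (xs ! n) else Point undefined)" for xs
  have pP: "pair p \<noteq> Point u" for p u by (simp add: pair_def split: prod.split)
  have code: "inj code"
  proof (rule injI)
    fix xs ys assume "code xs = code ys"
    then have *: "(if n < length xs then pair (xs ! n) else Point undefined) =
        (if n < length ys then pair (ys ! n) else Point undefined)" for n
      by (simp add: code_def fun_eq_iff)
    have "n < length xs \<longleftrightarrow> n < length ys" for n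
      using *[of n] pP by (metis (full_types))
    then have len: "length xs = length ys" by (meson linorder_neqE_nat less_irrefl)
    have "xs ! n = ys ! n" if "n < length xs" for n
      using *[of n] that len pair by (simp add: inj_eq)
    then show "xs = ys" using len by (simp add: nth_equalityI)
  qed
  have "inj_on (inv_into (combos e X) (functional oper X)) (omega_set oper e X)"
    unfolding omega_set_def by (rule inj_on_inv_into) simp
  then have "inj_on (code \<circ> inv_into (combos e X) (functional oper X)) (omega_set oper e X)"
    using code by (intro comp_inj_on) (auto intro: inj_on_subset)
  then have "\<exists>(K :: 'a universe metric) i. is_completion (omega oper e X) K i"
    using completion_exists coefficients.mspace_omega[OF assms] by metis
  then have "\<exists>p :: 'a universe metric \<times> _. case p of (K, i) \<Rightarrow> is_completion (omega oper e X) K i"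
    by auto
  then have "case (metric_completion (omega oper e X) :: 'a universe metric \<times> _) of
      (K, i) \<Rightarrow> is_completion (omega oper e X) K i"
    unfolding metric_completion_def by (rule someI_ex)
  then show ?thesis by (simp add: case_prod_beta)
qed

end

(*
  In J every binary operation s(p, q) = (a /\ p) \/ (b /\ q) satisfies s(p, s(p, q)) = s(p, q), because
  the coefficients lie in a distributive lattice; in I the operation t(p, q) = p \/ (-1 + q) does not,
  since t(p, t(p, q)) = p \/ (-2 + q).  A natural transformation that respects units and
  multiplications carries t to some s of this form, so it identifies t(p, t(p, q)) with t(p, q) and is
  not injective.  It suffices to compute with two points p, q at distance 1: all spaces that occur are
  then discrete, hence equal to their completions.
*)

theory Submission
  imports Defs
begin

section \<open>Discrete metric spaces\<close>

text \<open>An element \<mu> of I(X) with X = {p, q} is a binary operation in the free variables p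
  and q, and substitution is multiplication: t(p, t(p, q)) is zeta_X(I(f)(\<mu>)), where f : X ->
  I(X) sends p to the Dirac functional at p and q to \<mu>. Multiplicativity and naturality move the
  transformation a past zeta_X and I(f) and give xi_X(J(a o f)(a(\<mu>))). The unit law makes
  a(f(p)) the Dirac functional at p, so this is the same substitution performed in a(\<mu>), which
  is some finite combination over {p, q}. The coefficient -1 is chosen because it is not idempotent
  under addition; on [-\<infinity>, 0] only 0 and -\<infinity> are. The obstacle is that the action
  on maps and the multiplication are definite descriptions, over representing lists and over
  extensions to completions. On discrete spaces every function is continuous and every map is
  nonexpanding, so both kinds of description can be resolved and all computations take place on
  lists.\<close>

definition unit_discrete :: "'a metric \<Rightarrow> bool" where
  "unit_discrete X \<longleftrightarrow> (\<forall>x\<in>mspace X. \<forall>y\<in>mspace X. mdist X x y = (if x = y then 0 else 1))"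

lemma unit_discrete_metric: "unit_discrete (metric (A, \<lambda>x y. if x = y then 0 else 1))"
  and mspace_unit_discrete_metric: "mspace (metric (A, \<lambda>x y. if x = y then 0 else 1)) = A"
proof -
  interpret discrete_metric A .
  have eq: "(\<lambda>x y. if x = y then 0 else 1) = dd" by (simp add: dd_def)
  show "unit_discrete (metric (A, \<lambda>x y. if x = y then 0 else 1))"
    unfolding eq unit_discrete_def disc.mspace_metric disc.mdist_metric by (simp add: dd_def)
  show "mspace (metric (A, \<lambda>x y. if x = y then 0 else 1)) = A"
    unfolding eq by (rule disc.mspace_metric)
qed

lemma unit_discrete_ultrametric: "unit_discrete X \<Longrightarrow> ultrametric X"
  by (auto simp: unit_discrete_def ultrametric_def)

lemma unit_discrete_nonexpanding:
  assumes "unit_discrete X" "unit_discrete Y"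
  shows "nonexpanding X Y = mspace X \<rightarrow>\<^sub>E mspace Y"
proof -
  have "mdist Y (f x) (f y) \<le> mdist X x y"
    if "f \<in> mspace X \<rightarrow>\<^sub>E mspace Y" "x \<in> mspace X" "y \<in> mspace X" for f x y
  proof -
    have "f x \<in> mspace Y" "f y \<in> mspace Y" using that by auto
    then have "mdist Y (f x) (f y) = (if f x = f y then 0 else 1)" "mdist X x y = (if x = y then 0 else 1)"
      using assms that(2,3) by (auto simp: unit_discrete_def)
    then show ?thesis by simp
  qed
  then show ?thesis by (auto simp: nonexpanding_def)
qed

text \<open>Balls are open, so radius 1 still gives a singleton; this is why the threshold is
  \<open>r \<le> 1\<close>.\<close>

lemma unit_discrete_ball:
  assumes "unit_discrete X" "x \<in> mspace X" "0 < r"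
  shows "mball_of X x r = (if r \<le> 1 then {x} else mspace X)"
proof -
  have "y \<in> mball_of X x r \<longleftrightarrow> y \<in> (if r \<le> 1 then {x} else mspace X)" for y
    using assms by (cases "y = x") (auto simp: unit_discrete_def)
  then show ?thesis by blast
qed

lemma unit_discrete_ball_const_funs:
  assumes "unit_discrete X" "0 < r" "r \<le> 1"
  shows "ball_const_funs r X = extensional (mspace X)"
  using assms by (auto simp: ball_const_funs_def unit_discrete_ball constant_on_def)

lemma unit_discrete_cont_funs:
  assumes "unit_discrete X"
  shows "cont_funs X = extensional (mspace X)"
proof
  show "cont_funs X \<subseteq> extensional (mspace X)" by (auto simp: cont_funs_def)
  show "extensional (mspace X) \<subseteq> cont_funs X"
    using ball_const_funs_subset[of 1 X] unit_discrete_ball_const_funs[OF assms, of 1] by simp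
qed

text \<open>A point of \<open>K\<close> has image points arbitrarily near. Two image points within
  1/2 of it are at distance less than 1 from each other, hence coincide, so a single image point is
  arbitrarily near and equals it.\<close>

lemma unit_discrete_completion:
  assumes M: "unit_discrete M" and i: "is_completion M K i"
  shows "bij_betw i (mspace M) (mspace K)" and "unit_discrete K"
proof -
  interpret K: Metric_space "mspace K" "mdist K" by simp
  have dist: "mdist K (i x) (i y) = (if x = y then 0 else 1)" if "x \<in> mspace M" "y \<in> mspace M" for x y
    using that i M by (auto simp: is_completion_def unit_discrete_def)
  have iK: "i x \<in> mspace K" if "x \<in> mspace M" for x
    using that i by (auto simp: is_completion_def)
  have "y \<in> i ` mspace M" if y: "y \<in> mspace K" for y
  proof -
    have near: "\<exists>x\<in>mspace M. mdist K y (i x) < r" if "0 < r" for r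
    proof -
      have "y \<in> K.mtopology closure_of (i ` mspace M)"
        using i y by (simp add: is_completion_def mtopology_of_def)
      then show ?thesis using that unfolding K.metric_closure_of by auto
    qed
    obtain x where x: "x \<in> mspace M" "mdist K y (i x) < 1/2" using near[of "1/2"] by auto
    have "mdist K y (i x) < r" if r: "0 < r" for r
    proof -
      obtain x' where x': "x' \<in> mspace M" "mdist K y (i x') < min r (1/2)"
        using near[of "min r (1/2)"] r by auto
      have "mdist K (i x) (i x') \<le> mdist K (i x) y + mdist K y (i x')"
        using x x' y iK by (intro K.triangle)
      also have "\<dots> < 1" using x x' K.commute[of "i x" y] by simp
      finally have "x' = x" using dist[OF x(1) x'(1)] by (auto split: if_splits)
      then show ?thesis using x' by simp
    qed
    then have "mdist K y (i x) = 0"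
      by (metis K.nonneg less_irrefl less_eq_real_def)
    then show ?thesis using x(1) y iK by auto
  qed
  then have surj: "i ` mspace M = mspace K" using iK by blast
  moreover have inj: "inj_on i (mspace M)"
    using dist by (intro inj_onI) (metis zero_neq_one)
  ultimately show "bij_betw i (mspace M) (mspace K)" by (simp add: bij_betw_def)
  show "unit_discrete K"
    unfolding unit_discrete_def surj[symmetric] ball_simps by (simp add: dist inj_on_eq_iff[OF inj])
qed

text \<open>Terms at distance less than 1 are equal, so Cauchy sequences are eventually
  constant.\<close>

lemma unit_discrete_cumet:
  assumes "unit_discrete X"
  shows "X \<in> cumet"
proof -
  interpret Metric_space "mspace X" "mdist X" by simp
  have "mcomplete"
    unfolding mcomplete_def
  proof (intro allI impI)
    fix \<sigma> assume \<sigma>: "MCauchy \<sigma>"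
    then obtain N where N: "\<And>m n. N \<le> m \<Longrightarrow> N \<le> n \<Longrightarrow> mdist X (\<sigma> m) (\<sigma> n) < 1"
      unfolding MCauchy_def by (meson zero_less_one)
    have s: "\<sigma> n \<in> mspace X" for n using \<sigma> by (auto simp: MCauchy_def)
    have "\<sigma> n = \<sigma> N" if "N \<le> n" for n
      using N[OF that order.refl] assms s by (auto simp: unit_discrete_def split: if_splits)
    then have "limitin mtopology \<sigma> (\<sigma> N) sequentially"
      unfolding limit_metric_sequentially using s by (metis mdist_zero)
    then show "\<exists>x. limitin mtopology \<sigma> x sequentially" by blast
  qed
  then show ?thesis
    using assms by (simp add: cumet_def mcomplete_of_def unit_discrete_ultrametric)
qed

text \<open>Between discrete spaces every map is nonexpanding, so the extensions along a bijective
  embedding that are defined by \<open>THE\<close> exist.\<close>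

lemma extension_eq:
  assumes i: "bij_betw i A (mspace K)" and h: "h \<in> A \<rightarrow> mspace L"
    and K: "unit_discrete K" and L: "unit_discrete L" and m: "m \<in> A"
  defines "g \<equiv> THE g. g \<in> nonexpanding K L \<and> (\<forall>m\<in>A. g (i m) = h m)"
  shows "g (i m) = h m"
proof -
  define g' where "g' = (\<lambda>k\<in>mspace K. h (inv_into A i k))"
  have iA: "i m \<in> mspace K" if "m \<in> A" for m using i that by (auto simp: bij_betw_def)
  have inv: "inv_into A i k \<in> A" if "k \<in> mspace K" for k
    using i that by (simp add: bij_betw_def inv_into_into)
  have g': "g' \<in> nonexpanding K L \<and> (\<forall>m\<in>A. g' (i m) = h m)"
    unfolding unit_discrete_nonexpanding[OF K L] using h i inv iA
    by (auto simp: g'_def bij_betw_def inv_into_f_f Pi_iff)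
  have "g \<in> nonexpanding K L \<and> (\<forall>m\<in>A. g (i m) = h m)"
    unfolding g_def
  proof (rule theI[where P = "\<lambda>g. g \<in> nonexpanding K L \<and> (\<forall>m\<in>A. g (i m) = h m)", OF g'])
    fix u assume u: "u \<in> nonexpanding K L \<and> (\<forall>m\<in>A. u (i m) = h m)"
    show "u = g'"
    proof (rule extensionalityI[of _ "mspace K"])
      fix k assume "k \<in> mspace K"
      then obtain m where "m \<in> A" "k = i m" using i by (auto simp: bij_betw_def)
      then show "u k = g' k" using u g' by simp
    qed (use u g' in \<open>simp_all add: unit_discrete_nonexpanding[OF K L] PiE_def\<close>)
  qed
  then show ?thesis using m by blast
qed

section \<open>Functionals on discrete spaces\<close>

lemma functional_in_omega_set: "xs \<in> combos e X \<Longrightarrow> functional oper X xs \<in> omega_set oper e X"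
  by (simp add: omega_set_def)

lemma combos_map:
  assumes "xs \<in> combos e X" "\<And>x. x \<in> mspace X \<Longrightarrow> f x \<in> mspace Y"
  shows "[(\<alpha>, f x). (\<alpha>, x) \<leftarrow> xs] \<in> combos e Y"
proof -
  have "fst ` set [(\<alpha>, f x). (\<alpha>, x) \<leftarrow> xs] = fst ` set xs" by force
  then show ?thesis using assms by (auto simp: combos_def)
qed

lemma combos_mem:
  assumes "xs \<in> combos e X"
  shows "\<exists>x. (e, x) \<in> set xs"
proof -
  have "Max (fst ` set xs) \<in> fst ` set xs" using assms by (intro Max_in) (auto simp: combos_def)
  then show ?thesis using assms by (auto simp: combos_def)
qed

lemma combos_le: "xs \<in> combos e X \<Longrightarrow> (\<alpha>, x) \<in> set xs \<Longrightarrow> \<alpha> \<le> e"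
  by (force simp: combos_def intro!: Max_ge)

text \<open>Pushing forward along \<open>f\<close> is precomposing the argument with
  \<open>f\<close>. The right-hand side sees only the functional of \<open>xs\<close>, which gives
  independence of the representing list.\<close>

lemma functional_map:
  assumes X: "unit_discrete X" and Y: "unit_discrete Y" and xs: "xs \<in> combos e X"
    and \<phi>: "\<phi> \<in> extensional (mspace Y)"
  shows "functional oper Y [(\<alpha>, f x). (\<alpha>, x) \<leftarrow> xs] \<phi> = functional oper X xs (\<lambda>x\<in>mspace X. \<phi> (f x))"
proof -
  have "(\<lambda>(\<alpha>, x). oper \<alpha> (ereal (\<phi> x))) ` set [(\<alpha>, f x). (\<alpha>, x) \<leftarrow> xs] =
      (\<lambda>(\<alpha>, x). oper \<alpha> (ereal ((\<lambda>x\<in>mspace X. \<phi> (f x)) x))) ` set xs"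
    using xs by (auto simp: combos_def image_image intro!: image_cong)
  then show ?thesis
    using \<phi> by (simp add: functional_def unit_discrete_cont_funs X Y)
qed

lemma functional_apply:
  "\<phi> \<in> cont_funs X \<Longrightarrow>
    functional oper X xs \<phi> = real_of_ereal (MAX (\<alpha>, x)\<in>set xs. oper \<alpha> (ereal (\<phi> x)))"
  by (simp add: functional_def)

lemma functional_eqI:
  assumes "\<And>\<phi>. \<phi> \<in> cont_funs X \<Longrightarrow> functional oper X xs \<phi> = functional oper X ys \<phi>"
  shows "functional oper X xs = functional oper X ys"
  using assms by (auto simp: functional_def fun_eq_iff)

text \<open>These two laws make the multiplication well defined: associativity splits a flattened
  coefficient into an outer and an inner one, and monotonicity on the right lets
  \<open>oper \<alpha>\<close> pass through the inner maximum.\<close>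

locale monad_coefficients = coefficients +
  assumes oper_assoc: "oper (oper \<alpha> \<beta>) c = oper \<alpha> (oper \<beta> c)"
    and oper_mono_right: "c \<le> d \<Longrightarrow> oper \<alpha> c \<le> oper \<alpha> d"
begin

lemma unit_discrete_mspace_omega: "unit_discrete X \<Longrightarrow> mspace (omega oper e X) = omega_set oper e X"
  by (rule mspace_omega[OF unit_discrete_ultrametric])

text \<open>The maximum is finite, so \<open>real_of_ereal\<close> loses nothing: an entry with
  coefficient \<open>e\<close> bounds it below by a real value, and \<open>\<alpha> \<le> e\<close>
  bounds every term above by a value of \<phi>. This is needed when a functional value becomes the
  argument of an outer combination.\<close>

lemma ereal_functional:
  assumes xs: "xs \<in> combos e X" and "\<phi> \<in> cont_funs X"
  shows "ereal (functional oper X xs \<phi>) = (MAX (\<alpha>, x)\<in>set xs. oper \<alpha> (ereal (\<phi> x)))"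
proof -
  define S where "S = (\<lambda>(\<alpha>, x). oper \<alpha> (ereal (\<phi> x))) ` set xs"
  have S: "finite S" "S \<noteq> {}" using xs by (auto simp: S_def combos_def)
  obtain x where "(e, x) \<in> set xs" using combos_mem[OF xs] by blast
  then have "ereal (\<phi> x) \<in> S" by (auto simp: S_def oper_neutral intro!: image_eqI[of _ _ "(e, x)"])
  then have "ereal (\<phi> x) \<le> Max S" using S by simp
  moreover have "s < \<infinity>" if s: "s \<in> S" for s
  proof -
    obtain \<alpha> y where "(\<alpha>, y) \<in> set xs" "s = oper \<alpha> (ereal (\<phi> y))" using s by (auto simp: S_def)
    then have "s \<le> ereal (\<phi> y)" using oper_mono[OF combos_le[OF xs], of \<alpha> y "ereal (\<phi> y)"] by (simp add: oper_neutral)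
    then show ?thesis by (rule le_less_trans) simp
  qed
  then have "Max S < \<infinity>" using S by simp
  ultimately have "ereal (real_of_ereal (Max S)) = Max S" by (intro ereal_real') auto
  then show ?thesis using assms by (simp add: functional_def S_def)
qed

text \<open>For \<open>r \<le> 1\<close> the test functions are all continuous functions, which
  separate distinct functionals. For \<open>r > 1\<close> they are constants, on which all
  functionals agree. The infimum is therefore exactly 1.\<close>

lemma unit_discrete_omega:
  assumes X: "unit_discrete X"
  shows "unit_discrete (omega oper e X)"
proof -
  note X' = unit_discrete_ultrametric[OF X]
  have "dhat X \<mu> \<nu> = (if \<mu> = \<nu> then 0 else 1)"
    if \<mu>\<nu>: "\<mu> \<in> omega_set oper e X" "\<nu> \<in> omega_set oper e X" for \<mu> \<nu>
  proof (cases "\<mu> = \<nu>")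
    case True
    then have "{r. 0 < r \<and> (\<forall>\<phi>\<in>ball_const_funs r X. \<mu> \<phi> = \<nu> \<phi>)} = {0<..}" by auto
    then show ?thesis using True by (simp add: dhat_def)
  next
    case False
    obtain xs ys where xy: "xs \<in> combos e X" "ys \<in> combos e X"
      "\<mu> = functional oper X xs" "\<nu> = functional oper X ys"
      using \<mu>\<nu> by (auto simp: omega_set_def)
    obtain x0 where x0: "x0 \<in> mspace X" using xy(1) by (cases xs) (auto simp: combos_def)
    have "\<mu> \<phi> = \<nu> \<phi>" if "1 < r" "\<phi> \<in> ball_const_funs r X" for r \<phi>
    proof -
      have \<phi>: "\<phi> \<in> cont_funs X" using ball_const_funs_subset[of r X] that by auto
      have "\<phi> constant_on mspace X"
        using that x0 unit_discrete_ball[OF X x0, of r] by (auto simp: ball_const_funs_def)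
      then obtain c where "\<And>x. x \<in> mspace X \<Longrightarrow> \<phi> x = c" by (auto simp: constant_on_def)
      then have "functional oper X zs \<phi> = c" if "zs \<in> combos e X" for zs
        using that by (intro functional_const \<phi>) (auto simp: combos_def)
      then show ?thesis using xy by simp
    qed
    moreover have "\<not> (\<forall>\<phi>\<in>ball_const_funs r X. \<mu> \<phi> = \<nu> \<phi>)" if "0 < r" "r \<le> 1" for r
      using False functional_eqI[of X oper xs ys]
      unfolding unit_discrete_ball_const_funs[OF X that] unit_discrete_cont_funs[OF X] xy by blast
    ultimately have "{r. 0 < r \<and> (\<forall>\<phi>\<in>ball_const_funs r X. \<mu> \<phi> = \<nu> \<phi>)} = {1<..}"
      by force
    then show ?thesis using False by (simp add: dhat_def)
  qed
  then show ?thesis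
    unfolding unit_discrete_def unit_discrete_mspace_omega[OF X]
    by (simp add: omega_def Metric_space.mdist_metric[OF Metric_space_omega[OF X']])
qed

text \<open>By \<open>functional_map\<close> all lists representing the same functional have the
  same image, so the description in \<open>omega_map\<close> has a unique solution.\<close>

lemma omega_map_functional:
  assumes X: "unit_discrete X" and Y: "unit_discrete Y" and xs: "xs \<in> combos e X"
  shows "omega_map oper e X Y f (functional oper X xs) = functional oper Y [(\<alpha>, f x). (\<alpha>, x) \<leftarrow> xs]"
proof -
  have unique: "functional oper Y [(\<alpha>, f x). (\<alpha>, x) \<leftarrow> ys] = functional oper Y [(\<alpha>, f x). (\<alpha>, x) \<leftarrow> zs]"
    if "ys \<in> combos e X" "zs \<in> combos e X" "functional oper X ys = functional oper X zs" for ys zs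
  proof (rule functional_eqI)
    fix \<phi> assume "\<phi> \<in> cont_funs Y"
    then have "\<phi> \<in> extensional (mspace Y)" by (simp add: unit_discrete_cont_funs[OF Y])
    from functional_map[OF X Y that(1) this] functional_map[OF X Y that(2) this] that(3)
    show "functional oper Y [(\<alpha>, f x). (\<alpha>, x) \<leftarrow> ys] \<phi> = functional oper Y [(\<alpha>, f x). (\<alpha>, x) \<leftarrow> zs] \<phi>"
      by (simp only:)
  qed
  show ?thesis
    unfolding omega_map_def unit_discrete_mspace_omega[OF X]
      restrict_apply'[OF functional_in_omega_set[OF xs]]
  proof (rule the_equality)
    show "\<exists>ys\<in>combos e X. functional oper X xs = functional oper X ys \<and>
        functional oper Y [(\<alpha>, f x). (\<alpha>, x) \<leftarrow> xs] = functional oper Y [(\<alpha>, f x). (\<alpha>, x) \<leftarrow> ys]"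
      using xs by (intro bexI[of _ xs] conjI refl)
    fix \<nu>
    assume "\<exists>ys\<in>combos e X. functional oper X xs = functional oper X ys \<and>
      \<nu> = functional oper Y [(\<alpha>, f x). (\<alpha>, x) \<leftarrow> ys]"
    then obtain ys where ys: "ys \<in> combos e X" "functional oper X xs = functional oper X ys"
      "\<nu> = functional oper Y [(\<alpha>, f x). (\<alpha>, x) \<leftarrow> ys]" by blast
    show "\<nu> = functional oper Y [(\<alpha>, f x). (\<alpha>, x) \<leftarrow> xs]"
      unfolding ys(3) by (rule unique[OF ys(1) xs ys(2)[symmetric]])
  qed
qed

lemma omega_map_in:
  assumes X: "unit_discrete X" and Y: "unit_discrete Y" and f: "\<And>x. x \<in> mspace X \<Longrightarrow> f x \<in> mspace Y"
    and \<mu>: "\<mu> \<in> omega_set oper e X"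
  shows "omega_map oper e X Y f \<mu> \<in> omega_set oper e Y"
proof -
  obtain xs where xs: "xs \<in> combos e X" "\<mu> = functional oper X xs" using \<mu> by (auto simp: omega_set_def)
  show ?thesis
    unfolding xs(2) omega_map_functional[OF X Y xs(1)]
    by (intro functional_in_omega_set combos_map[OF xs(1)] f)
qed

lemma omega_map_inverse:
  assumes X: "unit_discrete X" and Y: "unit_discrete Y" and \<mu>: "\<mu> \<in> omega_set oper e X"
    and f: "\<And>x. x \<in> mspace X \<Longrightarrow> f x \<in> mspace Y" and gf: "\<And>x. x \<in> mspace X \<Longrightarrow> g (f x) = x"
  shows "omega_map oper e Y X g (omega_map oper e X Y f \<mu>) = \<mu>"
proof -
  obtain xs where xs: "xs \<in> combos e X" "\<mu> = functional oper X xs" using \<mu> by (auto simp: omega_set_def)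
  have "[(\<alpha>, g x). (\<alpha>, x) \<leftarrow> [(\<alpha>, f x). (\<alpha>, x) \<leftarrow> xs]] = xs"
    unfolding map_map by (rule map_idI) (use xs(1) gf in \<open>force simp: combos_def\<close>)
  then show ?thesis
    by (simp only: xs(2) omega_map_functional[OF X Y xs(1)] omega_map_functional[OF Y X combos_map[OF xs(1) f]])
qed

text \<open>Used with \<open>f\<close> the embedding into the completion: it makes the embedding of
  doubly iterated functionals, along which \<open>compl_mult\<close> is defined, a
  bijection.\<close>

lemma omega_map_bij:
  assumes X: "unit_discrete X" and Y: "unit_discrete Y" and f: "bij_betw f (mspace X) (mspace Y)"
  shows "bij_betw (omega_map oper e X Y f) (omega_set oper e X) (omega_set oper e Y)"
proof -
  show ?thesis
  proof (rule bij_betw_byWitness[where f' = "omega_map oper e Y X (inv_into (mspace X) f)"])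
    have inv: "inv_into (mspace X) f y \<in> mspace X" "f (inv_into (mspace X) f y) = y" if "y \<in> mspace Y" for y
      using that f by (auto simp: bij_betw_def inv_into_into f_inv_into_f)
    have fX: "f x \<in> mspace Y" "inv_into (mspace X) f (f x) = x" if "x \<in> mspace X" for x
      using that f by (auto simp: bij_betw_def)
    show "\<forall>\<mu>\<in>omega_set oper e X. omega_map oper e Y X (inv_into (mspace X) f) (omega_map oper e X Y f \<mu>) = \<mu>"
      by (rule ballI) (rule omega_map_inverse[OF X Y _ fX])
    show "\<forall>\<nu>\<in>omega_set oper e Y. omega_map oper e X Y f (omega_map oper e Y X (inv_into (mspace X) f) \<nu>) = \<nu>"
      by (rule ballI) (rule omega_map_inverse[OF Y X _ inv])
    show "omega_map oper e X Y f ` omega_set oper e X \<subseteq> omega_set oper e Y"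
      by (rule image_subsetI) (rule omega_map_in[OF X Y fX(1)])
    show "omega_map oper e Y X (inv_into (mspace X) f) ` omega_set oper e Y \<subseteq> omega_set oper e X"
      by (rule image_subsetI) (rule omega_map_in[OF Y X inv(1)])
  qed
qed

text \<open>The flattened combination is the outer functional evaluated at \<open>\<mu> \<mapsto> \<mu>(\<phi>)\<close>, hence it does not
  depend on the chosen representations.\<close>

lemma functional_flatten:
  assumes X: "unit_discrete X" and xss: "\<forall>(\<alpha>, xs)\<in>set xss. xs \<in> combos e X"
    and outer: "[(\<alpha>, functional oper X xs). (\<alpha>, xs) \<leftarrow> xss] \<in> combos e (omega oper e X)"
    and \<phi>: "\<phi> \<in> cont_funs X"
  shows "functional oper X [(oper \<alpha> \<beta>, x). (\<alpha>, xs) \<leftarrow> xss, (\<beta>, x) \<leftarrow> xs] \<phi> =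
    functional oper (omega oper e X) [(\<alpha>, functional oper X xs). (\<alpha>, xs) \<leftarrow> xss]
      (\<lambda>\<mu>\<in>mspace (omega oper e X). \<mu> \<phi>)"
proof -
  note omega = unit_discrete_mspace_omega[OF X]
  define S where "S xs = (\<lambda>(\<beta>, x). oper \<beta> (ereal (\<phi> x))) ` set xs" for xs :: "(ereal \<times> 'a) list"
  have S: "finite (S xs)" "S xs \<noteq> {}" "ereal (functional oper X xs \<phi>) = Max (S xs)"
    if "(\<alpha>, xs) \<in> set xss" for \<alpha> xs
    using that xss ereal_functional[OF _ \<phi>, of xs] by (auto simp: S_def combos_def)
  have ne: "xss \<noteq> []" using outer by (auto simp: combos_def)
  have "(MAX (\<alpha>, x)\<in>set [(oper \<alpha> \<beta>, x). (\<alpha>, xs) \<leftarrow> xss, (\<beta>, x) \<leftarrow> xs]. oper \<alpha> (ereal (\<phi> x))) =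
      Max (\<Union>(\<alpha>, xs)\<in>set xss. oper \<alpha> ` S xs)"
    by (rule arg_cong[of _ _ Max])
      (simp add: S_def image_UN image_image oper_assoc case_prod_beta)
  also have "\<dots> = (MAX (\<alpha>, xs)\<in>set xss. oper \<alpha> (Max (S xs)))"
  proof (rule Max_eqI)
    show "finite (\<Union>(\<alpha>, xs)\<in>set xss. oper \<alpha> ` S xs)" using S by auto
    have "(MAX (\<alpha>, xs)\<in>set xss. oper \<alpha> (Max (S xs))) \<in> (\<lambda>(\<alpha>, xs). oper \<alpha> (Max (S xs))) ` set xss"
      using ne by (intro Max_in) auto
    then show "(MAX (\<alpha>, xs)\<in>set xss. oper \<alpha> (Max (S xs))) \<in> (\<Union>(\<alpha>, xs)\<in>set xss. oper \<alpha> ` S xs)"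
      using S by (force intro!: imageI Max_in)
  next
    fix y assume "y \<in> (\<Union>(\<alpha>, xs)\<in>set xss. oper \<alpha> ` S xs)"
    then obtain \<alpha> xs s where *: "(\<alpha>, xs) \<in> set xss" "s \<in> S xs" "y = oper \<alpha> s" by auto
    then have "y \<le> oper \<alpha> (Max (S xs))" using S by (simp add: oper_mono_right)
    also have "\<dots> \<le> (MAX (\<alpha>, xs)\<in>set xss. oper \<alpha> (Max (S xs)))" using * by (force intro!: Max_ge)
    finally show "y \<le> (MAX (\<alpha>, xs)\<in>set xss. oper \<alpha> (Max (S xs)))" .
  qed
  also have "\<dots> = (MAX (\<alpha>, \<mu>)\<in>set [(\<alpha>, functional oper X xs). (\<alpha>, xs) \<leftarrow> xss].
      oper \<alpha> (ereal ((\<lambda>\<mu>\<in>mspace (omega oper e X). \<mu> \<phi>) \<mu>)))"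
  proof (rule arg_cong[of _ _ Max])
    have "(case p of (\<alpha>, xs) \<Rightarrow> oper \<alpha> (Max (S xs))) =
        (case p of (\<alpha>, xs) \<Rightarrow> oper \<alpha> (ereal ((\<lambda>\<mu>\<in>mspace (omega oper e X). \<mu> \<phi>) (functional oper X xs))))"
      if "p \<in> set xss" for p
      using that S xss functional_in_omega_set[of _ e X oper] by (auto simp: omega)
    then show "(\<lambda>(\<alpha>, xs). oper \<alpha> (Max (S xs))) ` set xss =
        (\<lambda>(\<alpha>, \<mu>). oper \<alpha> (ereal ((\<lambda>\<mu>\<in>mspace (omega oper e X). \<mu> \<phi>) \<mu>))) `
          set [(\<alpha>, functional oper X xs). (\<alpha>, xs) \<leftarrow> xss]"
      unfolding set_map image_image by (intro image_cong) (auto simp: case_prod_beta)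
  qed
  finally have eq: "real_of_ereal (MAX (\<alpha>, x)\<in>set [(oper \<alpha> \<beta>, x). (\<alpha>, xs) \<leftarrow> xss, (\<beta>, x) \<leftarrow> xs]. oper \<alpha> (ereal (\<phi> x))) =
    real_of_ereal (MAX (\<alpha>, \<mu>)\<in>set [(\<alpha>, functional oper X xs). (\<alpha>, xs) \<leftarrow> xss].
      oper \<alpha> (ereal ((\<lambda>\<mu>\<in>mspace (omega oper e X). \<mu> \<phi>) \<mu>)))"
    by (rule arg_cong)
  have eval: "(\<lambda>\<mu>\<in>mspace (omega oper e X). \<mu> \<phi>) \<in> cont_funs (omega oper e X)"
    unfolding unit_discrete_cont_funs[OF unit_discrete_omega[OF X]] by (rule restrict_extensional)
  from eq show ?thesis
    unfolding functional_apply[OF \<phi>] functional_apply[OF eval] .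
qed

text \<open>The maximum \<open>e\<close> is attained at an inner entry \<open>e\<close> below an
  outer entry \<open>e\<close>, and
  \<open>oper \<alpha> \<beta> \<le> oper e \<beta> = \<beta> \<le> e\<close> bounds all other
  coefficients.\<close>

lemma flatten_combos:
  assumes X: "unit_discrete X" and xss: "\<forall>(\<alpha>, xs)\<in>set xss. xs \<in> combos e X"
    and outer: "[(\<alpha>, functional oper X xs). (\<alpha>, xs) \<leftarrow> xss] \<in> combos e (omega oper e X)"
  shows "[(oper \<alpha> \<beta>, x). (\<alpha>, xs) \<leftarrow> xss, (\<beta>, x) \<leftarrow> xs] \<in> combos e X"
proof -
  let ?l = "[(oper \<alpha> \<beta>, x). (\<alpha>, xs) \<leftarrow> xss, (\<beta>, x) \<leftarrow> xs]"
  obtain xs where xs: "(e, xs) \<in> set xss" using combos_mem[OF outer] by auto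
  then obtain x where x: "(e, x) \<in> set xs" using combos_mem xss by blast
  have "(oper e e, x) \<in> set ?l"
    unfolding set_concat set_map image_image
    by (rule UN_I[OF xs]) (use x in force)
  then have mem: "(e, x) \<in> set ?l" by (simp only: oper_neutral)
  have "Max (fst ` set ?l) = e"
  proof (rule Max_eqI)
    show "e \<in> fst ` set ?l" using mem by (metis fst_conv image_eqI)
    fix \<gamma> assume "\<gamma> \<in> fst ` set ?l"
    then obtain \<alpha> ys \<beta> y where *: "(\<alpha>, ys) \<in> set xss" "(\<beta>, y) \<in> set ys" "\<gamma> = oper \<alpha> \<beta>" by auto
    have "\<alpha> \<le> e" by (rule combos_le[OF outer]) (use *(1) in force)
    then have "\<gamma> \<le> \<beta>" unfolding *(3) using oper_mono oper_neutral by metis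
    also have "\<beta> \<le> e" using *(1,2) xss combos_le[of ys e X \<beta> y] by blast
    finally show "\<gamma> \<le> e" .
  qed (rule finite_imageI, rule finite_set)
  moreover have "snd ` set ?l \<subseteq> mspace X" using xss by (fastforce simp: combos_def)
  moreover have "?l \<noteq> []" using mem by (metis empty_iff empty_set)
  ultimately show ?thesis by (simp add: combos_def)
qed

lemma omega_mult_functional:
  assumes X: "unit_discrete X" and xss: "\<forall>(\<alpha>, xs)\<in>set xss. xs \<in> combos e X"
    and outer: "[(\<alpha>, functional oper X xs). (\<alpha>, xs) \<leftarrow> xss] \<in> combos e (omega oper e X)"
  shows "omega_mult oper e X (functional oper (omega oper e X) [(\<alpha>, functional oper X xs). (\<alpha>, xs) \<leftarrow> xss]) =
    functional oper X [(oper \<alpha> \<beta>, x). (\<alpha>, xs) \<leftarrow> xss, (\<beta>, x) \<leftarrow> xs]"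
proof -
  have unique: "functional oper X [(oper \<alpha> \<beta>, x). (\<alpha>, xs) \<leftarrow> yss, (\<beta>, x) \<leftarrow> xs] =
      functional oper X [(oper \<alpha> \<beta>, x). (\<alpha>, xs) \<leftarrow> xss, (\<beta>, x) \<leftarrow> xs]"
    if "\<forall>(\<alpha>, xs)\<in>set yss. xs \<in> combos e X"
      "[(\<alpha>, functional oper X xs). (\<alpha>, xs) \<leftarrow> yss] \<in> combos e (omega oper e X)"
      "functional oper (omega oper e X) [(\<alpha>, functional oper X xs). (\<alpha>, xs) \<leftarrow> xss] =
       functional oper (omega oper e X) [(\<alpha>, functional oper X xs). (\<alpha>, xs) \<leftarrow> yss]" for yss
    by (rule functional_eqI)
      (simp only: functional_flatten[OF X that(1,2)] functional_flatten[OF X xss outer] that(3))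
  show ?thesis
    unfolding omega_mult_def unit_discrete_mspace_omega[OF unit_discrete_omega[OF X]]
      restrict_apply'[OF functional_in_omega_set[OF outer]]
  proof (rule the_equality, intro exI[of _ xss] conjI xss outer refl)
    fix \<nu>
    assume "\<exists>yss. (\<forall>(\<alpha>, xs)\<in>set yss. xs \<in> combos e X) \<and>
      [(\<alpha>, functional oper X xs). (\<alpha>, xs) \<leftarrow> yss] \<in> combos e (omega oper e X) \<and>
      functional oper (omega oper e X) [(\<alpha>, functional oper X xs). (\<alpha>, xs) \<leftarrow> xss] =
        functional oper (omega oper e X) [(\<alpha>, functional oper X xs). (\<alpha>, xs) \<leftarrow> yss] \<and>
      \<nu> = functional oper X [(oper \<alpha> \<beta>, x). (\<alpha>, xs) \<leftarrow> yss, (\<beta>, x) \<leftarrow> xs]"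
    then show "\<nu> = functional oper X [(oper \<alpha> \<beta>, x). (\<alpha>, xs) \<leftarrow> xss, (\<beta>, x) \<leftarrow> xs]"
      by (elim exE conjE) (simp only: unique)
  qed
qed

text \<open>An outer list carries functionals, whereas \<open>omega_mult\<close> works with lists of
  lists; choosing a representing list for each inner functional bridges the two.\<close>

lemma omega_omega_cases:
  assumes X: "unit_discrete X" and M: "M \<in> omega_set oper e (omega oper e X)"
  obtains xss where "\<forall>(\<alpha>, xs)\<in>set xss. xs \<in> combos e X"
    "[(\<alpha>, functional oper X xs). (\<alpha>, xs) \<leftarrow> xss] \<in> combos e (omega oper e X)"
    "M = functional oper (omega oper e X) [(\<alpha>, functional oper X xs). (\<alpha>, xs) \<leftarrow> xss]"
proof -
  obtain ms where ms: "ms \<in> combos e (omega oper e X)" "M = functional oper (omega oper e X) ms"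
    using M by (auto simp: omega_set_def)
  define c where "c = inv_into (combos e X) (functional oper X)"
  have c: "c \<mu> \<in> combos e X" "functional oper X (c \<mu>) = \<mu>" if "(\<alpha>, \<mu>) \<in> set ms" for \<alpha> \<mu>
  proof -
    have "\<mu> \<in> functional oper X ` combos e X"
    proof -
      have "\<mu> \<in> mspace (omega oper e X)" using ms(1) that by (force simp: combos_def)
      then show ?thesis by (simp only: unit_discrete_mspace_omega[OF X] omega_set_def)
    qed
    then show "c \<mu> \<in> combos e X" "functional oper X (c \<mu>) = \<mu>"
      unfolding c_def by (rule inv_into_into, rule f_inv_into_f)
  qed
  define xss where "xss = [(\<alpha>, c \<mu>). (\<alpha>, \<mu>) \<leftarrow> ms]"
  have "[(\<alpha>, functional oper X xs). (\<alpha>, xs) \<leftarrow> xss] = ms"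
    unfolding xss_def map_map by (rule map_idI) (use c in force)
  moreover have "\<forall>(\<alpha>, xs)\<in>set xss. xs \<in> combos e X" using c by (auto simp: xss_def)
  ultimately show ?thesis using ms that by metis
qed

section \<open>The monads on discrete spaces\<close>

lemma
  assumes X: "unit_discrete X"
  shows compl_ob_discrete: "unit_discrete (compl_ob oper e X)"
    and compl_emb_bij: "bij_betw (compl_emb oper e X) (omega_set oper e X) (mspace (compl_ob oper e X))"
proof -
  have "is_completion (omega oper e X) (compl_ob oper e X) (compl_emb oper e X)"
    unfolding compl_ob_def compl_emb_def
    by (rule completion_omega[OF coefficients_axioms unit_discrete_ultrametric[OF X]])
  from unit_discrete_completion[OF unit_discrete_omega[OF X] this]
  show "unit_discrete (compl_ob oper e X)"
    "bij_betw (compl_emb oper e X) (omega_set oper e X) (mspace (compl_ob oper e X))"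
    by (simp_all add: unit_discrete_mspace_omega[OF X])
qed

lemma compl_emb_in:
  assumes "unit_discrete X" "xs \<in> combos e X"
  shows "compl_emb oper e X (functional oper X xs) \<in> mspace (compl_ob oper e X)"
  by (rule bij_betwE[OF compl_emb_bij[OF assms(1)], rule_format, OF functional_in_omega_set[OF assms(2)]])

lemma compl_ob_cases:
  assumes "unit_discrete X" "m \<in> mspace (compl_ob oper e X)"
  obtains xs where "xs \<in> combos e X" "m = compl_emb oper e X (functional oper X xs)"
  using assms(2) compl_emb_bij[OF assms(1)] that unfolding bij_betw_def omega_set_def by blast

lemma compl_map_functional:
  assumes X: "unit_discrete X" and Y: "unit_discrete Y" and f: "\<And>x. x \<in> mspace X \<Longrightarrow> f x \<in> mspace Y"
    and xs: "xs \<in> combos e X"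
  shows "compl_map oper e X Y f (compl_emb oper e X (functional oper X xs)) =
    compl_emb oper e Y (functional oper Y [(\<alpha>, f x). (\<alpha>, x) \<leftarrow> xs])"
proof -
  have "compl_emb oper e Y (omega_map oper e X Y f \<mu>) \<in> mspace (compl_ob oper e Y)"
    if "\<mu> \<in> omega_set oper e X" for \<mu>
    by (rule bij_betwE[OF compl_emb_bij[OF Y], rule_format, OF omega_map_in[OF X Y f that]])
  then have "(\<lambda>\<mu>. compl_emb oper e Y (omega_map oper e X Y f \<mu>)) \<in> omega_set oper e X \<rightarrow> mspace (compl_ob oper e Y)"
    by (rule Pi_I)
  from extension_eq[OF compl_emb_bij[OF X] this compl_ob_discrete[OF X] compl_ob_discrete[OF Y]
      functional_in_omega_set[OF xs]]
  show ?thesis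
    unfolding compl_map_def unit_discrete_mspace_omega[OF X] omega_map_functional[OF X Y xs] .
qed

text \<open>The composite embedding \<open>i\<close> in the definition of \<open>compl_mult\<close>
  is a bijection on discrete spaces, so \<open>extension_eq\<close> resolves the description there
  and leaves the flattening of lists.\<close>

lemma compl_mult_functional:
  assumes X: "unit_discrete X" and xss: "\<forall>(\<alpha>, xs)\<in>set xss. xs \<in> combos e X"
    and outer: "[(\<alpha>, functional oper X xs). (\<alpha>, xs) \<leftarrow> xss] \<in> combos e (omega oper e X)"
  shows "compl_mult oper e X (compl_emb oper e (compl_ob oper e X) (functional oper (compl_ob oper e X)
      [(\<alpha>, compl_emb oper e X (functional oper X xs)). (\<alpha>, xs) \<leftarrow> xss])) =
    compl_emb oper e X (functional oper X [(oper \<alpha> \<beta>, x). (\<alpha>, xs) \<leftarrow> xss, (\<beta>, x) \<leftarrow> xs])"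
proof -
  let ?O = "omega oper e X" and ?T = "compl_ob oper e X"
  define i where "i = (\<lambda>M. compl_emb oper e ?T (omega_map oper e ?O ?T (compl_emb oper e X) M))"
  note O = unit_discrete_omega[OF X] and T = compl_ob_discrete[OF X]
  note mO = unit_discrete_mspace_omega[OF O]
  have "bij_betw i (omega_set oper e ?O) (mspace (compl_ob oper e ?T))"
  proof -
    have "bij_betw (omega_map oper e ?O ?T (compl_emb oper e X)) (omega_set oper e ?O) (omega_set oper e ?T)"
      by (rule omega_map_bij[OF O T]) (simp add: unit_discrete_mspace_omega[OF X] compl_emb_bij[OF X])
    from bij_betw_trans[OF this compl_emb_bij[OF T]] show ?thesis by (simp add: i_def comp_def)
  qed
  moreover have "(\<lambda>M. compl_emb oper e X (omega_mult oper e X M)) \<in> omega_set oper e ?O \<rightarrow> mspace ?T"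
  proof
    fix M assume "M \<in> omega_set oper e ?O"
    then obtain yss where yss: "\<forall>(\<alpha>, xs)\<in>set yss. xs \<in> combos e X"
        "[(\<alpha>, functional oper X xs). (\<alpha>, xs) \<leftarrow> yss] \<in> combos e ?O"
        "M = functional oper ?O [(\<alpha>, functional oper X xs). (\<alpha>, xs) \<leftarrow> yss]"
      by (rule omega_omega_cases[OF X])
    show "compl_emb oper e X (omega_mult oper e X M) \<in> mspace ?T"
      unfolding yss(3) omega_mult_functional[OF X yss(1,2)]
      by (intro compl_emb_in[OF X] flatten_combos[OF X yss(1,2)])
  qed
  ultimately have "compl_mult oper e X (i M) = compl_emb oper e X (omega_mult oper e X M)"
    if "M \<in> omega_set oper e ?O" for M
    using extension_eq[of i, OF _ _ compl_ob_discrete[OF T] T that]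
    unfolding compl_mult_def mO i_def by blast
  from this[OF functional_in_omega_set[OF outer]] show ?thesis
    unfolding i_def omega_map_functional[OF O T outer] omega_mult_functional[OF X xss outer]
    by (simp add: split_def comp_def)
qed

lemma singleton_combos: "x \<in> mspace X \<Longrightarrow> [(e, x)] \<in> combos e X"
  by (simp add: combos_def)

lemma functional_singleton: "functional oper X [(e, x)] = dirac X x"
  by (simp add: functional_def dirac_def oper_neutral)

lemma compl_unit_functional:
  "x \<in> mspace X \<Longrightarrow> compl_unit oper e X x = compl_emb oper e X (functional oper X [(e, x)])"
  by (simp add: compl_unit_def functional_singleton)

end

interpretation I: monad_coefficients "(+)" 0
  by unfold_locales (auto intro: add_left_mono simp: add.assoc)

interpretation J: monad_coefficients min \<infinity>
  by unfold_locales (auto simp: min.assoc min_le_iff_disj)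

section \<open>The two monads are not isomorphic\<close>

text \<open>If \<open>xs\<close> represents \<open>s(p, q)\<close>, the list on the left is the flattening of \<open>s(p, s(p, q))\<close>.\<close>

lemma J_substitution_idempotent:
  "functional min X [(min \<alpha> \<beta>, y). (\<alpha>, ys) \<leftarrow> [(\<alpha>, if x = p then [(\<infinity>, p)] else xs). (\<alpha>, x) \<leftarrow> xs], (\<beta>, y) \<leftarrow> ys] =
    functional min X xs" (is "functional min X ?l = _")
proof (rule functional_eqI)
  fix \<phi> assume \<phi>: "\<phi> \<in> cont_funs X"
  let ?v = "\<lambda>(\<alpha>, x). min \<alpha> (ereal (\<phi> x))"
  have mem: "z \<in> set [(min \<alpha> \<beta>, y). (\<alpha>, ys) \<leftarrow> [(\<alpha>, r x). (\<alpha>, x) \<leftarrow> xs], (\<beta>, y) \<leftarrow> ys] \<longleftrightarrow>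
      (\<exists>\<alpha> x \<beta> y. (\<alpha>, x) \<in> set xs \<and> (\<beta>, y) \<in> set (r x) \<and> z = (min \<alpha> \<beta>, y))"
    for z and r :: "_ \<Rightarrow> (ereal \<times> _) list"
    by force
  \<comment> \<open>An entry at \<open>p\<close> recurs through the coefficient \<infinity>; any
    other entry recurs by being substituted into itself, since \<open>min\<close> is
    idempotent.\<close>
  have sub: "set xs \<subseteq> set ?l"
  proof
    fix z assume z: "z \<in> set xs"
    obtain \<alpha> x where ax: "z = (\<alpha>, x)" by (cases z)
    then have "(if x = p then \<infinity> else \<alpha>, x) \<in> set (if x = p then [(\<infinity>, p)] else xs)"
      "z = (min \<alpha> (if x = p then \<infinity> else \<alpha>), x)"
      using z by auto
    then show "z \<in> set ?l" unfolding mem using z unfolding ax by (intro exI conjI)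
  qed
  \<comment> \<open>Substitution at \<open>p\<close> leaves an entry unchanged, and elsewhere the
    outer coefficient can only lower an entry of \<open>xs\<close>. Flattening thus creates no
    larger value.\<close>
  have le: "\<exists>w\<in>set xs. ?v z \<le> ?v w" if z: "z \<in> set ?l" for z
  proof -
    obtain \<alpha> x \<beta> y where *: "(\<alpha>, x) \<in> set xs" "(\<beta>, y) \<in> set (if x = p then [(\<infinity>, p)] else xs)" "z = (min \<alpha> \<beta>, y)"
      using z unfolding mem by blast
    show ?thesis
    proof (cases "x = p")
      case True
      then have "?v z \<le> ?v (\<alpha>, x)" using * by simp
      then show ?thesis using *(1) by blast
    next
      case False
      have "?v z \<le> ?v (\<beta>, y)" unfolding *(3) by (auto simp: min_le_iff_disj)
      moreover have "(\<beta>, y) \<in> set xs" using *(2) False by simp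
      ultimately show ?thesis by blast
    qed
  qed
  have "Max (?v ` set ?l) = Max (?v ` set xs)"
  proof (cases "xs = []")
    case False
    have fin: "finite (?v ` set ?l)" by (rule finite_imageI, rule finite_set)
    have ne: "?v ` set xs \<noteq> {}" using False by simp
    then have "?v ` set ?l \<noteq> {}" using image_mono[OF sub, of ?v] by (metis subset_empty)
    with fin have "Max (?v ` set ?l) \<le> Max (?v ` set xs)"
    proof (rule Max.boundedI)
      fix c assume "c \<in> ?v ` set ?l"
      then obtain w where "w \<in> set xs" "c \<le> ?v w" using le by blast
      then show "c \<le> Max (?v ` set xs)" by (meson Max_ge finite_imageI finite_set image_eqI order_trans)
    qed
    moreover have "Max (?v ` set xs) \<le> Max (?v ` set ?l)"
      by (rule Max_mono[OF image_mono[OF sub] ne fin])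
    ultimately show ?thesis by (rule antisym)
  qed simp
  then show "functional min X ?l \<phi> = functional min X xs \<phi>"
    unfolding functional_apply[OF \<phi>] by (rule arg_cong)
qed

text \<open>The left list is the flattening of t(p, t(p, q)). Its entry \<open>(-1, p)\<close> is
  dominated by \<open>(0, p)\<close>, so the two sides differ in the coefficient of
  \<open>q\<close>, -2 against -1.\<close>

lemma I_substitution_not_idempotent:
  assumes X: "unit_discrete X" and pq: "p \<in> mspace X" "q \<in> mspace X" "p \<noteq> q"
  shows "functional (+) X [(0, p), (-1, p), (-1 + -1, q)] \<noteq> functional (+) X [(0, p), (-1, q)]"
proof -
  \<comment> \<open>The value 10 is large enough for the entry at \<open>q\<close> to dominate on
    both sides, giving 10 - 2 and 10 - 1.\<close>
  define \<phi> :: "_ \<Rightarrow> real" where "\<phi> = (\<lambda>x\<in>mspace X. if x = q then 10 else 0)"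
  have \<phi>: "\<phi> \<in> cont_funs X" by (simp add: unit_discrete_cont_funs[OF X] \<phi>_def)
  have v: "\<phi> p = 0" "\<phi> q = 10" using pq by (auto simp: \<phi>_def)
  have "functional (+) X [(0, p), (-1, p), (-1 + -1, q)] \<phi> = 8"
    unfolding functional_apply[OF \<phi>] by (simp add: v one_ereal_def flip: ereal_max)
  moreover have "functional (+) X [(0, p), (-1, q)] \<phi> = 9"
    unfolding functional_apply[OF \<phi>] by (simp add: v one_ereal_def flip: ereal_max)
  ultimately show ?thesis by auto
qed

theorem theorem5p5:
  shows "\<not> (\<exists>a. natural_isomorphism (I_monad :: 'a universe monad_data) J_monad a \<and>
                monad_morphism (I_monad :: 'a universe monad_data) J_monad a)"
proof
  assume "\<exists>a. natural_isomorphism (I_monad :: 'a universe monad_data) J_monad a \<and>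
    monad_morphism (I_monad :: 'a universe monad_data) J_monad a"
  then obtain a where iso: "natural_isomorphism (I_monad :: 'a universe monad_data) J_monad a"
    and mor: "monad_morphism (I_monad :: 'a universe monad_data) J_monad a" by blast
  \<comment> \<open>The type of base points may have a single element, so the two points come from
    different constructors.\<close>
  define p q :: "'a universe" where "p = Point undefined" and "q = Seq (\<lambda>_. Point undefined)"
  have pq: "p \<noteq> q" by (simp add: p_def q_def)
  define X where "X = metric ({p, q}, \<lambda>x y. if x = y then 0 else 1)"
  have X: "unit_discrete X" and mX: "mspace X = {p, q}"
    by (simp_all only: X_def unit_discrete_metric mspace_unit_discrete_metric)
  define IX JX where "IX = compl_ob (+) 0 X" and "JX = compl_ob min \<infinity> X"
  have IX: "unit_discrete IX" and JX: "unit_discrete JX"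
    unfolding IX_def JX_def by (rule I.compl_ob_discrete[OF X] J.compl_ob_discrete[OF X])+
  note cumet = unit_discrete_cumet[OF X] unit_discrete_cumet[OF IX]
  have sel: "Ob I_monad = compl_ob (+) 0" "Map I_monad = compl_map (+) 0"
    "Unit I_monad = compl_unit (+) 0" "Mult I_monad = compl_mult (+) 0"
    "Ob J_monad = compl_ob min \<infinity>" "Map J_monad = compl_map min \<infinity>"
    "Unit J_monad = compl_unit min \<infinity>" "Mult J_monad = compl_mult min \<infinity>"
    by (simp_all add: I_monad_def J_monad_def compl_monad_def)
  have nat: "natural_transformation (I_monad :: 'a universe monad_data) J_monad a"
    using mor by (simp add: monad_morphism_def)
  have aX: "a X m \<in> mspace JX" if "m \<in> mspace IX" for m
    using nat that cumet(1) by (auto simp: natural_transformation_def nonexpanding_def sel IX_def JX_def)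
  have inj: "inj_on (a X) (mspace IX)"
  proof -
    obtain b where "compose (mspace IX) b (a X) = (\<lambda>x\<in>mspace IX. x)"
      using iso cumet(1) unfolding natural_isomorphism_def sel IX_def by blast
    then have "b (a X m) = m" if "m \<in> mspace IX" for m
      using that by (metis compose_eq restrict_apply')
    then show ?thesis by (rule inj_on_inverseI)
  qed

  define t where "t xs = compl_emb (+) 0 X (functional (+) X xs)" for xs
  define u where "u xs = compl_emb min \<infinity> X (functional min X xs)" for xs
  have t: "t xs \<in> mspace IX" if "xs \<in> combos 0 X" for xs
    unfolding t_def IX_def by (rule I.compl_emb_in[OF X that])
  have ps: "[(0, p)] \<in> combos 0 X" "[(0, p), (-1, q)] \<in> combos 0 X"
    by (auto simp: combos_def mX max_def)
  define \<mu> where "\<mu> = t [(0, p), (-1, q)]"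
  have \<mu>: "\<mu> \<in> mspace IX" unfolding \<mu>_def by (rule t[OF ps(2)])
  \<comment> \<open>The embedding is onto, so the image of t(p, q) is a finite combination: this is
    s(p, q), where \<open>xs\<close> may list a point repeatedly.\<close>
  obtain xs where xs: "xs \<in> combos \<infinity> X" "a X \<mu> = u xs"
    using J.compl_ob_cases[OF X, of "a X \<mu>"] aX[OF \<mu>] unfolding JX_def u_def by blast

  \<comment> \<open>The substitution that fixes p and replaces q by t(p, q); below, \<open>M\<close>
    is its action on \<mu>, and multiplying \<open>M\<close> yields t(p, t(p, q)).\<close>
  define f where "f = (\<lambda>x\<in>mspace X. if x = p then t [(0, p)] else \<mu>)"
  have fin: "f x \<in> mspace IX" if "x \<in> mspace X" for x
    using that t[OF ps(1)] \<mu> by (simp add: f_def)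
  have f: "f \<in> nonexpanding X IX"
    unfolding unit_discrete_nonexpanding[OF X IX] using fin by (auto simp: f_def)
  have fpq: "f p = t [(0, p)]" "f q = t [(0, p), (-1, q)]" using pq by (auto simp: f_def mX \<mu>_def)

  define M where "M = compl_map (+) 0 X IX f \<mu>"
  have M: "M = compl_emb (+) 0 IX (functional (+) IX [(0, t [(0, p)]), (-1, t [(0, p), (-1, q)])])"
  proof -
    have "M = compl_emb (+) 0 IX (functional (+) IX [(\<alpha>, f x). (\<alpha>, x) \<leftarrow> [(0, p), (-1, q)]])"
      unfolding M_def \<mu>_def t_def by (rule I.compl_map_functional[OF X IX fin ps(2)])
    then show ?thesis by (simp add: fpq)
  qed
  let ?xss = "[(0, [(0, p)]), (-1, [(0, p), (-1, q)])] :: (ereal \<times> (ereal \<times> 'a universe) list) list"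
  have outer: "[(\<alpha>, functional (+) X xs). (\<alpha>, xs) \<leftarrow> ?xss] \<in> combos 0 (omega (+) 0 X)"
    using functional_in_omega_set[OF ps(1)] functional_in_omega_set[OF ps(2)]
    by (auto simp: combos_def max_def I.unit_discrete_mspace_omega[OF X])
  have "compl_mult (+) 0 X M = t [(\<alpha> + \<beta>, x). (\<alpha>, xs) \<leftarrow> ?xss, (\<beta>, x) \<leftarrow> xs]"
    using I.compl_mult_functional[OF X _ outer] ps unfolding M IX_def t_def by simp
  then have mult_I: "compl_mult (+) 0 X M = t [(0, p), (-1, p), (-1 + -1, q)]" by simp
  have M_in: "M \<in> mspace (compl_ob (+) 0 IX)"
    unfolding M by (rule I.compl_emb_in[OF IX]) (use t[OF ps(1)] t[OF ps(2)] in \<open>auto simp: combos_def max_def\<close>)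

  have "compl_mult min \<infinity> X (compl_map min \<infinity> IX JX (a X) (a IX M)) = a X (compl_mult (+) 0 X M)"
  proof -
    have "compose (mspace (compl_ob (+) 0 IX)) (compl_mult min \<infinity> X)
        (compose (mspace (compl_ob (+) 0 IX)) (compl_map min \<infinity> IX JX (a X)) (a IX)) =
      compose (mspace (compl_ob (+) 0 IX)) (a X) (compl_mult (+) 0 X)"
      using mor cumet(1) unfolding monad_morphism_def sel IX_def JX_def by blast
    from fun_cong[OF this, of M] show ?thesis by (simp add: compose_eq M_in)
  qed
  moreover have "a IX M = compl_map min \<infinity> X IX f (a X \<mu>)"
  proof -
    have "compose (mspace IX) (compl_map min \<infinity> X IX f) (a X) = compose (mspace IX) (a IX) (compl_map (+) 0 X IX f)"
      using nat cumet f unfolding natural_transformation_def sel IX_def by blast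
    from fun_cong[OF this, of \<mu>] show ?thesis by (simp add: compose_eq \<mu> M_def)
  qed
  \<comment> \<open>In J the two actions together relabel \<open>xs\<close> by \<open>a X\<close>
    after \<open>f\<close>, so the multiplication flattens s(p, s(p, q)), which collapses to s(p,
    q).\<close>
  moreover have "compl_mult min \<infinity> X (compl_map min \<infinity> IX JX (a X) (compl_map min \<infinity> X IX f (u xs))) = u xs"
  proof -
    \<comment> \<open>A list representing \<open>a X (f x)\<close>: by the unit law at
      \<open>p\<close>, by the choice of \<open>xs\<close> at \<open>q\<close>.\<close>
    define rep where "rep x = (if x = p then [(\<infinity>, p)] else xs)" for x
    have rep: "rep x \<in> combos \<infinity> X" if "x \<in> mspace X" for x
      using xs(1) J.singleton_combos[of p X] by (simp add: rep_def mX)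
    have unit: "a X (t [(0, p)]) = u [(\<infinity>, p)]"
    proof -
      have "compose (mspace X) (a X) (compl_unit (+) 0 X) = compl_unit min \<infinity> X"
        using mor cumet(1) unfolding monad_morphism_def sel by blast
      from fun_cong[OF this, of p] show ?thesis
        by (simp add: compose_eq mX I.compl_unit_functional J.compl_unit_functional t_def u_def)
    qed
    have af: "a X (f x) = u (rep x)" if "x \<in> mspace X" for x
      using that unit xs(2) by (auto simp: f_def rep_def)
    let ?yss = "[(\<alpha>, rep x). (\<alpha>, x) \<leftarrow> xs]"
    have yss: "\<forall>(\<alpha>, ys)\<in>set ?yss. ys \<in> combos \<infinity> X"
    proof -
      have "x \<in> mspace X" if "(\<alpha>, x) \<in> set xs" for \<alpha> x using that xs(1) by (force simp: combos_def)
      then show ?thesis using rep by auto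
    qed
    have outer_J: "[(\<alpha>, functional min X ys). (\<alpha>, ys) \<leftarrow> ?yss] \<in> combos \<infinity> (omega min \<infinity> X)"
    proof -
      have "[(\<alpha>, functional min X ys). (\<alpha>, ys) \<leftarrow> ?yss] = [(\<alpha>, functional min X (rep x)). (\<alpha>, x) \<leftarrow> xs]"
        by (simp add: case_prod_beta comp_def)
      also have "\<dots> \<in> combos \<infinity> (omega min \<infinity> X)"
        by (rule combos_map[OF xs(1)]) (simp add: J.unit_discrete_mspace_omega[OF X] functional_in_omega_set rep)
      finally show ?thesis .
    qed
    have "compl_map min \<infinity> IX JX (a X) (compl_map min \<infinity> X IX f (u xs)) =
        compl_emb min \<infinity> JX (functional min JX [(\<alpha>, a X m). (\<alpha>, m) \<leftarrow> [(\<alpha>, f x). (\<alpha>, x) \<leftarrow> xs]])"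
    proof -
      have "compl_map min \<infinity> X IX f (u xs) =
          compl_emb min \<infinity> IX (functional min IX [(\<alpha>, f x). (\<alpha>, x) \<leftarrow> xs])"
        unfolding u_def by (rule J.compl_map_functional[OF X IX fin xs(1)])
      moreover have "compl_map min \<infinity> IX JX (a X)
            (compl_emb min \<infinity> IX (functional min IX [(\<alpha>, f x). (\<alpha>, x) \<leftarrow> xs])) =
          compl_emb min \<infinity> JX (functional min JX [(\<alpha>, a X m). (\<alpha>, m) \<leftarrow> [(\<alpha>, f x). (\<alpha>, x) \<leftarrow> xs]])"
        by (rule J.compl_map_functional[OF IX JX aX combos_map[OF xs(1) fin]])
      ultimately show ?thesis by simp
    qed
    also have "[(\<alpha>, a X m). (\<alpha>, m) \<leftarrow> [(\<alpha>, f x). (\<alpha>, x) \<leftarrow> xs]] = [(\<alpha>, u ys). (\<alpha>, ys) \<leftarrow> ?yss]"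
      unfolding map_map by (rule map_cong[OF refl]) (use af xs(1) in \<open>force simp: combos_def\<close>)
    finally show ?thesis
      using J.compl_mult_functional[OF X yss outer_J] J_substitution_idempotent[of X p xs]
      by (simp only: u_def JX_def rep_def)
  qed
  \<comment> \<open>The chain is multiplicativity at \<open>M\<close>, naturality along
    \<open>f\<close>, and the collapse in J; injectivity of \<open>a X\<close> then identifies the
    two elements of \<open>IX\<close>.\<close>
  ultimately have "a X (t [(0, p), (-1, p), (-1 + -1, q)]) = a X \<mu>"
    using mult_I xs(2) by simp
  moreover have ps': "[(0, p), (-1, p), (-1 + -1, q)] \<in> combos 0 X"
    by (auto simp: combos_def mX max_def one_ereal_def)
  ultimately have "t [(0, p), (-1, p), (-1 + -1, q)] = t [(0, p), (-1, q)]"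
    using inj_onD[OF inj _ t \<mu>] unfolding \<mu>_def by blast
  then have "functional (+) X [(0, p), (-1, p), (-1 + -1, q)] = functional (+) X [(0, p), (-1, q)]"
    unfolding t_def
    by (rule inj_onD[OF bij_betw_imp_inj_on[OF I.compl_emb_bij[OF X]]])
      (intro functional_in_omega_set ps ps')+
  then show False
    using I_substitution_not_idempotent[OF X _ _ pq] mX by blast
qed

end
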